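(* Let $n\ge1$ be an integer. Assume that $u$ is the Poisson extension to $B_1(0)$ of a distribution $T\in(C^\infty(S^1))'$ which almost changes its sign for $2n$ times on $S^1$, and that $u$ has $n$ nodal curves intersecting at $0$ in $B_1(0)$. Suppose $u=\mathrm{Re}\,w$ is an extremer of the curvature bound, i.e. for some nodal curve $\gamma\subset Z(u)$ through $0$, $$\Big|\kappa(u)|_{\gamma}(0)\Big|=\frac{4(n+1)}{n}\ \text{ if } n \text{ is odd},\qquad \Big|\kappa(u)|_{\gamma}(0)\Big|=\frac{4(n+1)}{n}\cos\frac{\pi}{2(n+1)}\ \text{ if } n\text{ is even}.$$ Then, after multiplying $u$ by a constant and applying a rotation, $$w(z)=\frac{z^n}{(1-e^{-i\varphi_0}z)^{2n}}+\frac{2z^{n+1}}{(1-e^{-i\varphi_0}z)^{2n+1}}\,e^{-i(n+1)\varphi_0}\cos n\varphi_0,$$ where $$\varphi_0=\frac{k\pi}{n}+\frac{\pi}{2n(n+1)}\,l,$$ with $l=0$ if $n$ is odd, $l=1$ if $n$ is even, and $0\le k\le n-1$ an integer.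
   Context: $B_1(0)$ is the open unit disk in $\mathbb{R}^2\cong\mathbb{C}$ and $S^1$ its boundary, with functions on $S^1$ identified with $2\pi$-periodic functions of $\theta$. Distributions are real-valued on real functions. A distribution $T\in(C^\infty(S^1))'$ almost changes its sign for $2n$ times on $S^1$ if there exists a (real) function $g_0\in C^\infty(S^1)$ with $2n$ zeros, counted with multiplicity, such that $T(g_0f)\ge0$ for every smooth function $f\ge0$ on $S^1$. The Poisson extension of $T$ is $u(re^{i\theta})=T(P_r(\theta-\cdot))$, where $P_r(\theta)=\frac{1}{2\pi}\frac{1-r^2}{1-2r\cos\theta+r^2}$. $w$ is the holomorphic function on $B_1(0)$ with $\mathrm{Re}\,w=u$ and $w(0)=u(0)=0$. The nodal set $Z(u)=\{u=0\}$ is a union of maximal real-analytic curves called nodal curves; "$u$ has $n$ nodal curves intersecting at $0$" means $n$ nodal curves pass through $0$, i.e. $u$ vanishes at $0$ to order exactly $n$. $\kappa(u)|_\gamma(0)$ is the curvature of the nodal curve $\gamma$ at $0$. "After multiplying by a constant and rotation" means after replacing $u(z)$ by $c\,u(e^{i\alpha}z)$ for suitable real constants $c\ne0$ and $\alpha$.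
   Formalization: For even n the conclusion is proved with l = 1 or l = −1 instead of l = 1 only: the reflection u(z̄) of an extremer is again an extremer, replaces φ₀ by −φ₀, and is not related to the l = 1 function by a rotation and a real constant. *)

theory Defs
  imports "HOL-Complex_Analysis.Complex_Analysis"
begin

text \<open>Functions on the unit circle are represented by $2\pi$-periodic functions of the angle.\<close>

definition smooth_circle :: "(real \<Rightarrow> real) set" where
  "smooth_circle = {f. (\<forall>x. f (x + 2 * pi) = f x) \<and>
                       (\<forall>k x. (deriv ^^ k) f differentiable (at x))}"

text \<open>Continuity for the usual Frechet topology is expressed by an estimate against
  finitely many of the defining seminorms; the suprema are finite by periodicity.\<close>

definition circle_distribution :: "((real \<Rightarrow> real) \<Rightarrow> real) \<Rightarrow> bool" where
  "circle_distribution T \<longleftrightarrow>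
     (\<forall>f \<in> smooth_circle. \<forall>g \<in> smooth_circle. T (\<lambda>x. f x + g x) = T f + T g) \<and>
     (\<forall>f \<in> smooth_circle. \<forall>c. T (\<lambda>x. c * f x) = c * T f) \<and>
     (\<exists>C N. \<forall>f \<in> smooth_circle. \<bar>T f\<bar> \<le> C * (\<Sum>k\<le>N. SUP x. \<bar>(deriv ^^ k) f x\<bar>))"

definition zero_mult :: "(real \<Rightarrow> real) \<Rightarrow> real \<Rightarrow> nat" where
  "zero_mult g x = (LEAST m. (deriv ^^ m) g x \<noteq> 0)"

text \<open>All zeros on the circle must have finite order, so that \<open>zero_mult\<close> is meaningful.\<close>

definition circle_zero_count :: "(real \<Rightarrow> real) \<Rightarrow> nat \<Rightarrow> bool" where
  "circle_zero_count g m \<longleftrightarrow>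
     finite {x \<in> {0..<2 * pi}. g x = 0} \<and>
     (\<forall>x. g x = 0 \<longrightarrow> (\<exists>k. (deriv ^^ k) g x \<noteq> 0)) \<and>
     (\<Sum>x | x \<in> {0..<2 * pi} \<and> g x = 0. zero_mult g x) = m"

definition almost_changes_sign :: "((real \<Rightarrow> real) \<Rightarrow> real) \<Rightarrow> nat \<Rightarrow> bool" where
  "almost_changes_sign T m \<longleftrightarrow>
     (\<exists>g \<in> smooth_circle. circle_zero_count g m \<and>
        (\<forall>f \<in> smooth_circle. (\<forall>x. f x \<ge> 0) \<longrightarrow> T (\<lambda>x. g x * f x) \<ge> 0))"

definition poisson_kernel :: "real \<Rightarrow> real \<Rightarrow> real" where
  "poisson_kernel r \<theta> = 1 / (2 * pi) * ((1 - r\<^sup>2) / (1 - 2 * r * cos \<theta> + r\<^sup>2))"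

text \<open>The choice of argument is immaterial, as the kernel is periodic in the angle and
  constant for $r = 0$.\<close>

definition poisson_extension :: "((real \<Rightarrow> real) \<Rightarrow> real) \<Rightarrow> complex \<Rightarrow> real" where
  "poisson_extension T z = T (\<lambda>t. poisson_kernel (cmod z) (Arg z - t))"

definition partial_x :: "(complex \<Rightarrow> real) \<Rightarrow> complex \<Rightarrow> real" where
  "partial_x u z = deriv (\<lambda>t. u (z + complex_of_real t)) 0"

definition partial_y :: "(complex \<Rightarrow> real) \<Rightarrow> complex \<Rightarrow> real" where
  "partial_y u z = deriv (\<lambda>t. u (z + \<i> * complex_of_real t)) 0"

definition vanishes_to_order :: "(complex \<Rightarrow> real) \<Rightarrow> nat \<Rightarrow> complex \<Rightarrow> bool" where
  "vanishes_to_order u n z \<longleftrightarrow>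
     (\<forall>a b. a + b < n \<longrightarrow> (partial_x ^^ a) ((partial_y ^^ b) u) z = 0) \<and>
     (\<exists>a b. a + b = n \<and> (partial_x ^^ a) ((partial_y ^^ b) u) z \<noteq> 0)"

definition real_analytic_curve_on :: "(real \<Rightarrow> complex) \<Rightarrow> real set \<Rightarrow> bool" where
  "real_analytic_curve_on \<gamma> I \<longleftrightarrow>
     (\<forall>t \<in> I. \<exists>(a :: nat \<Rightarrow> complex) r. r > 0 \<and>
        (\<forall>s. \<bar>s - t\<bar> < r \<longrightarrow> (\<lambda>k. a k * complex_of_real (s - t) ^ k) sums \<gamma> s))"

definition curve_deriv :: "(real \<Rightarrow> complex) \<Rightarrow> real \<Rightarrow> complex" where
  "curve_deriv \<gamma> t = vector_derivative \<gamma> (at t)"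

text \<open>A nodal arc is a regular real-analytic parametrized curve inside the zero set of \<open>u\<close>
  in the unit disk; a nodal curve is a nodal arc with maximal trace.\<close>

definition nodal_arc :: "(complex \<Rightarrow> real) \<Rightarrow> real set \<Rightarrow> (real \<Rightarrow> complex) \<Rightarrow> bool" where
  "nodal_arc u I \<gamma> \<longleftrightarrow>
     open I \<and> is_interval I \<and> real_analytic_curve_on \<gamma> I \<and>
     (\<forall>t \<in> I. curve_deriv \<gamma> t \<noteq> 0 \<and> \<gamma> t \<in> ball 0 1 \<and> u (\<gamma> t) = 0)"

definition nodal_curve :: "(complex \<Rightarrow> real) \<Rightarrow> real set \<Rightarrow> (real \<Rightarrow> complex) \<Rightarrow> bool" where
  "nodal_curve u I \<gamma> \<longleftrightarrow>
     nodal_arc u I \<gamma> \<and>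
     (\<forall>J \<delta>. nodal_arc u J \<delta> \<and> \<gamma> ` I \<subseteq> \<delta> ` J \<longrightarrow> \<delta> ` J = \<gamma> ` I)"

text \<open>Signed curvature $(x'y'' - y'x'') / (x'^2 + y'^2)^{3/2}$.\<close>

definition curvature :: "(real \<Rightarrow> complex) \<Rightarrow> real \<Rightarrow> real" where
  "curvature \<gamma> t =
     Im (cnj (curve_deriv \<gamma> t) * curve_deriv (curve_deriv \<gamma>) t) / cmod (curve_deriv \<gamma> t) ^ 3"

definition curvature_bound :: "nat \<Rightarrow> real" where
  "curvature_bound n =
     (if odd n then 4 * (real n + 1) / real n
      else 4 * (real n + 1) / real n * cos (pi / (2 * (real n + 1))))"

definition extremal_function :: "nat \<Rightarrow> real \<Rightarrow> complex \<Rightarrow> complex" where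
  "extremal_function n \<phi> z =
     z ^ n / (1 - exp (- (\<i> * complex_of_real \<phi>)) * z) ^ (2 * n) +
     2 * z ^ (n + 1) / (1 - exp (- (\<i> * complex_of_real \<phi>)) * z) ^ (2 * n + 1) *
       exp (- (\<i> * complex_of_real ((real n + 1) * \<phi>))) * complex_of_real (cos (real n * \<phi>))"

text \<open>Parameters of the extremal angle
  $\varphi_0 = k \pi / n + l \pi / (2 n (n+1))$. For even \<open>n\<close> both signs of \<open>l\<close> occur:
  complex conjugation of the disk preserves all hypotheses and the absolute value of the
  curvature but changes $\varphi_0$ into $-\varphi_0$, and for even \<open>n\<close> the two resulting
  functions are not related by a rotation and a real factor.\<close>

definition extremal_shifts :: "nat \<Rightarrow> real set" where
  "extremal_shifts n = (if odd n then {0} else {1, -1})"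

end

theory Submission
  imports Defs
begin

text \<open>Dividing the multiplier by a trigonometric polynomial $p$ with the same $2n$ zeros
  $\theta_j$ leaves a smooth function of constant sign, so $\nu = \pm p\,T$ is a positive
  functional. Since $u$ vanishes to order $n$, the Fourier coefficients $t_k$ of $T$ are $0$ for
  $|k| < n$; with $\kappa$ the coefficient of $e^{-in\theta}$ in $\pm p$ this gives
  $\nu_0 = 2\,\mathrm{Re}\,q$, where $q = \kappa t_n$, and
  $t_{n+1}/t_n = \nu_1/q + \sum_j e^{-i\theta_j}$.
  The curvature is, up to the factor $2/n$, the imaginary part of $t_{n+1}/t_n$ in the tangent
  direction. Positivity gives $|\nu_1| \le \nu_0$, so the curvature is bounded by a sum of $2n+2$
  cosines: one angle for each zero and twice the phase of $q$. The reality of $p$ and the tangent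
  condition force these angles to sum to $(n+1)\pi$ modulo $2\pi$, and under this constraint the
  sum of cosines is largest only if all angles agree. In the extremal case all zeros therefore
  coincide and $|\nu_1| = \nu_0$, so $\nu$ is a point mass at that zero; the linear recursion
  between the coefficients of $\nu$ and of $T$ then determines $w$. Rotating by $\pi/n$ changes
  the sign of the extremal function, hence $k = 0$ always suffices.\<close>

subsection \<open>Smooth functions on the line\<close>

text \<open>Nothing is evaluated on the circle itself: every fact about \<open>T\<close> is a
  relation between Fourier coefficients, found by testing against smooth functions. A half-angle
  sine changes sign under a shift by 2 pi, so an even number of them, here 2n, is a function on the
  circle. In the curvature condition each zero contributes one cosine, while |nu_1| <= nu_0 = 2 |q|
  cos psi, with psi the phase of q, contributes at most 2 cos psi. For odd n all angles can be 0,
  since (n+1) pi is a multiple of 2 pi; this is the bound without a cosine factor. For even n the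
  sum of the angles is an odd multiple of pi, and sharing pi equally gives the angle a = pi/(2n+2)
  and the factor cos a, with either sign of the common angle. The cosine is not concave on [0, pi],
  which rules out Jensen's inequality; the tangent at a replaces it, since a <= pi/6 for n >= 2. The
  common angle delta equals n phi_0, and nu_0/kappa = 2 t_n cos(delta) e^{-i delta} is the origin of
  the cosine and of the phase in the second term of \<open>extremal_function\<close>.\<close>

definition differentiable_upto :: "nat \<Rightarrow> real set \<Rightarrow> (real \<Rightarrow> real) \<Rightarrow> bool" where
  "differentiable_upto k S f \<longleftrightarrow> (\<forall>j<k. \<forall>x\<in>S. (deriv ^^ j) f differentiable (at x))"

text \<open>The set \<open>S\<close> is there because the quotient of the two multipliers is first
  known only near each point. Counting orders in \<open>differentiable_upto\<close> allows
  induction: the derivative of a product or reciprocal involves \<open>f\<close> and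
  \<open>deriv f\<close> to one order less.\<close>

definition smooth_on :: "real set \<Rightarrow> (real \<Rightarrow> real) \<Rightarrow> bool" where
  "smooth_on S f \<longleftrightarrow> (\<forall>k. differentiable_upto k S f)"

lemma differentiable_upto_0 [simp]: "differentiable_upto 0 S f"
  by (simp add: differentiable_upto_def)

lemma differentiable_upto_Suc:
  "differentiable_upto (Suc k) S f \<longleftrightarrow>
     (\<forall>x\<in>S. f differentiable (at x)) \<and> differentiable_upto k S (deriv f)"
  unfolding differentiable_upto_def
proof (intro iffI conjI ballI allI impI)
  fix j x assume *: "\<forall>j<Suc k. \<forall>x\<in>S. (deriv ^^ j) f differentiable at x" and "x \<in> S"
  show "f differentiable at x" using *[rule_format, of 0 x] \<open>x \<in> S\<close> by simp
  assume "j < k"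
  then show "(deriv ^^ j) (deriv f) differentiable at x"
    using *[rule_format, of "Suc j" x] \<open>x \<in> S\<close> by (simp add: funpow_swap1)
next
  fix j x assume *: "(\<forall>x\<in>S. f differentiable at x) \<and> (\<forall>j<k. \<forall>x\<in>S. (deriv ^^ j) (deriv f) differentiable at x)"
    and "x \<in> S" "j < Suc k"
  then show "(deriv ^^ j) f differentiable at x"
    by (cases j) (auto simp: funpow_swap1)
qed

lemma differentiable_upto_SucD: "differentiable_upto (Suc k) S f \<Longrightarrow> differentiable_upto k S f"
  by (auto simp: differentiable_upto_def)

lemma deriv_cong_open:
  fixes f g :: "real \<Rightarrow> real"
  assumes "open S" "\<And>y. y \<in> S \<Longrightarrow> f y = g y" "x \<in> S"
  shows "deriv f x = deriv g x"
proof -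
  have "eventually (\<lambda>y. f y = g y) (nhds x)"
    using assms by (auto simp: eventually_nhds)
  then show ?thesis by (intro deriv_cong_ev) auto
qed

lemma differentiable_cong_open:
  fixes f g :: "real \<Rightarrow> real"
  assumes "open S" "\<And>y. y \<in> S \<Longrightarrow> f y = g y" "x \<in> S" "f differentiable (at x)"
  shows "g differentiable (at x)"
  using assms unfolding differentiable_def
  by (meson has_derivative_transform_within_open)

lemma differentiable_upto_cong:
  assumes "open S" "\<And>y. y \<in> S \<Longrightarrow> f y = g y" "differentiable_upto k S f"
  shows "differentiable_upto k S g"
  using assms
proof (induction k arbitrary: f g)
  case (Suc k)
  have "deriv f y = deriv g y" if "y \<in> S" for y
    using deriv_cong_open[OF Suc.prems(1,2) that] by simp
  moreover have "differentiable_upto k S (deriv f)"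
    using Suc.prems by (simp add: differentiable_upto_Suc)
  ultimately have "differentiable_upto k S (deriv g)"
    using Suc.IH[OF Suc.prems(1)] by blast
  moreover have "g differentiable (at x)" if "x \<in> S" for x
    using differentiable_cong_open[OF Suc.prems(1,2) that] Suc.prems(3) that
    by (auto simp: differentiable_upto_Suc)
  ultimately show ?case by (simp add: differentiable_upto_Suc)
qed simp

lemma differentiable_upto_SucI:
  assumes "open S" "\<And>x. x \<in> S \<Longrightarrow> (f has_real_derivative f' x) (at x)" "differentiable_upto k S f'"
  shows "differentiable_upto (Suc k) S f"
proof -
  have "deriv f x = f' x" if "x \<in> S" for x using assms(2)[OF that] by (rule DERIV_imp_deriv)
  then have "differentiable_upto k S (deriv f)"
    using differentiable_upto_cong[OF assms(1) _ assms(3), of "deriv f"] by simp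
  moreover have "\<forall>x\<in>S. f differentiable (at x)"
    using assms(2) real_differentiable_def by blast
  ultimately show ?thesis by (simp add: differentiable_upto_Suc)
qed

lemma differentiable_upto_SucE:
  assumes "differentiable_upto (Suc k) S f" "x \<in> S"
  shows "(f has_real_derivative deriv f x) (at x)"
  using assms by (simp add: differentiable_upto_Suc DERIV_deriv_iff_real_differentiable)

lemma differentiable_upto_const: "open S \<Longrightarrow> differentiable_upto k S (\<lambda>x. c)"
proof (induction k arbitrary: c)
  case (Suc k)
  show ?case by (rule differentiable_upto_SucI[where f' = "\<lambda>_. 0"]) (use Suc in \<open>auto\<close>)
qed simp

lemma differentiable_upto_add:
  "open S \<Longrightarrow> differentiable_upto k S f \<Longrightarrow> differentiable_upto k S g \<Longrightarrow>
     differentiable_upto k S (\<lambda>x. f x + g x)"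
proof (induction k arbitrary: f g)
  case (Suc k)
  show ?case
  proof (rule differentiable_upto_SucI[where f' = "\<lambda>x. deriv f x + deriv g x"])
    show "((\<lambda>x. f x + g x) has_real_derivative deriv f x + deriv g x) (at x)" if "x \<in> S" for x
      using Suc.prems that by (intro DERIV_add differentiable_upto_SucE)
  qed (use Suc in \<open>auto simp: differentiable_upto_Suc\<close>)
qed simp

lemma differentiable_upto_mult:
  "open S \<Longrightarrow> differentiable_upto k S f \<Longrightarrow> differentiable_upto k S g \<Longrightarrow>
     differentiable_upto k S (\<lambda>x. f x * g x)"
proof (induction k arbitrary: f g)
  case (Suc k)
  show ?case
  proof (rule differentiable_upto_SucI[where f' = "\<lambda>x. deriv f x * g x + deriv g x * f x"])
    show "((\<lambda>x. f x * g x) has_real_derivative deriv f x * g x + deriv g x * f x) (at x)" if "x \<in> S" for x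
      using Suc.prems that by (intro DERIV_mult differentiable_upto_SucE)
    show "differentiable_upto k S (\<lambda>x. deriv f x * g x + deriv g x * f x)"
      using Suc.prems
      by (intro differentiable_upto_add Suc.IH differentiable_upto_SucD[of k S f]
            differentiable_upto_SucD[of k S g]) (auto simp: differentiable_upto_Suc)
  qed fact
qed simp

lemma differentiable_upto_inverse:
  "open S \<Longrightarrow> differentiable_upto k S f \<Longrightarrow> (\<And>x. x \<in> S \<Longrightarrow> f x \<noteq> 0) \<Longrightarrow>
     differentiable_upto k S (\<lambda>x. inverse (f x))"
proof (induction k)
  case (Suc k)
  \<comment> \<open>The derivative -f'/f^2 is written with two reciprocal factors, each covered by
    the induction hypothesis at order k.\<close>
  show ?case
  proof (rule differentiable_upto_SucI[where f' = "\<lambda>x. (- 1) * (inverse (f x) * deriv f x * inverse (f x))"])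
    show "((\<lambda>x. inverse (f x)) has_real_derivative (- 1) * (inverse (f x) * deriv f x * inverse (f x))) (at x)"
      if "x \<in> S" for x
      using DERIV_inverse'[OF differentiable_upto_SucE[OF Suc.prems(2) that]] Suc.prems(3)[OF that] by simp
    show "differentiable_upto k S (\<lambda>x. (- 1) * (inverse (f x) * deriv f x * inverse (f x)))"
      using Suc.prems
      by (intro differentiable_upto_mult Suc.IH differentiable_upto_const differentiable_upto_SucD[of k S f])
         (auto simp: differentiable_upto_Suc)
  qed fact
qed simp

lemma smooth_on_const: "open S \<Longrightarrow> smooth_on S (\<lambda>x. c)"
  by (simp add: smooth_on_def differentiable_upto_const)

lemma smooth_on_add: "open S \<Longrightarrow> smooth_on S f \<Longrightarrow> smooth_on S g \<Longrightarrow> smooth_on S (\<lambda>x. f x + g x)"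
  by (simp add: smooth_on_def differentiable_upto_add)

lemma smooth_on_mult: "open S \<Longrightarrow> smooth_on S f \<Longrightarrow> smooth_on S g \<Longrightarrow> smooth_on S (\<lambda>x. f x * g x)"
  by (simp add: smooth_on_def differentiable_upto_mult)

lemma smooth_on_prod:
  "open S \<Longrightarrow> (\<And>i. i \<in> A \<Longrightarrow> smooth_on S (f i)) \<Longrightarrow> smooth_on S (\<lambda>x. \<Prod>i\<in>A. f i x)"
  by (induction A rule: infinite_finite_induct) (auto intro: smooth_on_const smooth_on_mult)

lemma smooth_on_power: "open S \<Longrightarrow> smooth_on S f \<Longrightarrow> smooth_on S (\<lambda>x. f x ^ m)"
  by (induction m) (auto intro: smooth_on_const smooth_on_mult)

lemma smooth_on_inverse:
  "open S \<Longrightarrow> smooth_on S f \<Longrightarrow> (\<And>x. x \<in> S \<Longrightarrow> f x \<noteq> 0) \<Longrightarrow> smooth_on S (\<lambda>x. inverse (f x))"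
  by (simp add: smooth_on_def differentiable_upto_inverse)

lemma smooth_on_cong:
  "open S \<Longrightarrow> smooth_on S f \<Longrightarrow> (\<And>y. y \<in> S \<Longrightarrow> f y = g y) \<Longrightarrow> smooth_on S g"
  unfolding smooth_on_def using differentiable_upto_cong by blast

lemma smooth_on_subset: "smooth_on S f \<Longrightarrow> R \<subseteq> S \<Longrightarrow> smooth_on R f"
  by (auto simp: smooth_on_def differentiable_upto_def)

lemma smooth_on_locally:
  "(\<And>x. x \<in> S \<Longrightarrow> \<exists>U. x \<in> U \<and> smooth_on U f) \<Longrightarrow> smooth_on S f"
  unfolding smooth_on_def differentiable_upto_def by blast

lemma smooth_on_imp_derivative:
  "smooth_on S f \<Longrightarrow> x \<in> S \<Longrightarrow> ((deriv ^^ k) f has_real_derivative (deriv ^^ Suc k) f x) (at x)"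
  by (auto simp: smooth_on_def differentiable_upto_def DERIV_deriv_iff_real_differentiable)

lemma smooth_on_imp_continuous: "smooth_on S f \<Longrightarrow> x \<in> S \<Longrightarrow> isCont f x"
  using smooth_on_imp_derivative[of S f x 0] DERIV_isCont by auto

text \<open>A derivative tower certifies smoothness without identifying iterated \<open>deriv\<close> beforehand.\<close>

lemma deriv_tower:
  assumes "\<And>k x. (h k has_real_derivative h (Suc k) x) (at x)"
  shows "(deriv ^^ k) (h 0) = h k" and "smooth_on S (h 0)"
proof -
  show *: "(deriv ^^ k) (h 0) = h k" for k
    by (induction k) (auto intro!: ext DERIV_imp_deriv assms)
  show "smooth_on S (h 0)"
    unfolding smooth_on_def differentiable_upto_def * using assms real_differentiable_def by blast
qed

section \<open>Smooth periodic functions and division by zeros of finite order\<close>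

lemma smooth_circle_iff:
  "f \<in> smooth_circle \<longleftrightarrow> (\<forall>x. f (x + 2 * pi) = f x) \<and> smooth_on UNIV f"
  by (auto simp: smooth_circle_def smooth_on_def differentiable_upto_def)

lemma smooth_circle_tower:
  assumes "\<And>k x. (h k has_real_derivative h (Suc k) x) (at x)" "\<And>x. h 0 (x + 2 * pi) = h 0 x"
  shows "h 0 \<in> smooth_circle"
  using assms deriv_tower(2)[of h UNIV] by (simp add: smooth_circle_iff)

lemma smooth_circle_mult: "f \<in> smooth_circle \<Longrightarrow> g \<in> smooth_circle \<Longrightarrow> (\<lambda>x. f x * g x) \<in> smooth_circle"
  by (simp add: smooth_circle_iff smooth_on_mult)

lemma smooth_circle_add: "f \<in> smooth_circle \<Longrightarrow> g \<in> smooth_circle \<Longrightarrow> (\<lambda>x. f x + g x) \<in> smooth_circle"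
  by (simp add: smooth_circle_iff smooth_on_add)

lemma smooth_circle_const: "(\<lambda>x. c) \<in> smooth_circle"
  by (simp add: smooth_circle_iff smooth_on_const)

lemma smooth_circle_scale: "f \<in> smooth_circle \<Longrightarrow> (\<lambda>x. c * f x) \<in> smooth_circle"
  by (intro smooth_circle_mult smooth_circle_const)

lemma smooth_sin_half: "smooth_on S (\<lambda>x. sin ((x - a) / 2))"
proof -
  \<comment> \<open>Each derivative advances the phase by pi/2 and brings a factor 1/2.\<close>
  define h where "h k x = (1/2) ^ k * sin ((x - a) / 2 + real k * (pi / 2))" for k x
  have "(h k has_real_derivative h (Suc k) x) (at x)" for k x
  proof -
    have "sin ((x - a) / 2 + real (Suc k) * (pi / 2)) = cos ((x - a) / 2 + real k * (pi / 2))"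
      using sin_add[of "(x - a) / 2 + real k * (pi / 2)" "pi / 2"] by (simp add: algebra_simps add_divide_distrib)
    moreover have "(h k has_real_derivative (1/2)^k * (cos ((x - a) / 2 + real k * (pi / 2)) * (1/2))) (at x)"
      unfolding h_def by (auto intro!: derivative_eq_intros)
    ultimately show ?thesis by (simp add: h_def mult_ac)
  qed
  from deriv_tower(2)[of h, OF this] show ?thesis by (simp add: h_def [abs_def])
qed

text \<open>The quotient is the mean of f' over the segment from a to x, the integral of f'(a + s(x
  - a)) over 0 <= s <= 1. Differentiating under the integral inserts a factor s each time, and at x
  = a the integral of s^k gives 1/(k+1).\<close>

lemma hadamard_division:
  assumes f: "smooth_on UNIV f" and "f a = 0"
  obtains h where "smooth_on UNIV h" "\<And>x. f x = (x - a) * h x" 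
    "\<And>k. (deriv ^^ k) h a = (deriv ^^ Suc k) f a / real (Suc k)"
proof -
  define h where "h k x = integral {0..1} (\<lambda>s. s ^ k * (deriv ^^ Suc k) f (a + s * (x - a)))" for k x
  have der: "((deriv ^^ k) f has_real_derivative (deriv ^^ Suc k) f x) (at x)" for k x
    using smooth_on_imp_derivative[OF f] by blast
  have contUNIV: "continuous_on UNIV ((deriv ^^ k) f)" for k
    using der DERIV_isCont by (meson continuous_at_imp_continuous_on)
  have cont: "continuous_on S (\<lambda>p. (deriv ^^ k) f (g p))" if "continuous_on S g" for k S and g :: "'a::topological_space \<Rightarrow> real"
    by (rule continuous_on_compose2[OF contUNIV that]) auto
  have hd: "(h k has_real_derivative h (Suc k) x) (at x)" for k x
  proof -
    have "((\<lambda>x. integral (cbox 0 1) (\<lambda>s. s ^ k * (deriv ^^ Suc k) f (a + s * (x - a)))) has_real_derivative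
       integral (cbox 0 1) (\<lambda>s. s ^ Suc k * (deriv ^^ Suc (Suc k)) f (a + s * (x - a)))) (at x within UNIV)"
    proof (rule leibniz_rule_field_derivative)
      fix x s :: real
      have "((\<lambda>x. (deriv ^^ Suc k) f (a + s * (x - a))) has_real_derivative
          (deriv ^^ Suc (Suc k)) f (a + s * (x - a)) * s) (at x)"
        by (rule DERIV_chain2[OF der]) (auto intro!: derivative_eq_intros)
      from DERIV_cmult[OF this, of "s ^ k"]
      show "((\<lambda>x. s ^ k * (deriv ^^ Suc k) f (a + s * (x - a))) has_real_derivative
         s ^ Suc k * (deriv ^^ Suc (Suc k)) f (a + s * (x - a))) (at x)"
        by (simp only: power_Suc mult_ac)
    next
      fix x :: real
      show "(\<lambda>s. s ^ k * (deriv ^^ Suc k) f (a + s * (x - a))) integrable_on cbox 0 1"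
        by (intro integrable_continuous continuous_intros cont)
    next
      show "continuous_on (UNIV \<times> cbox 0 1) (\<lambda>(x, s). s ^ Suc k * (deriv ^^ Suc (Suc k)) f (a + s * (x - a)))"
        unfolding split_beta by (intro continuous_intros cont)
    qed auto
    then show ?thesis by (simp add: h_def [abs_def])
  qed
  have "f x = (x - a) * h 0 x" for x
  proof -
    have "((\<lambda>s. (x - a) * deriv f (a + s * (x - a))) has_integral f (a + 1 * (x - a)) - f (a + 0 * (x - a))) {0..1}"
    proof (rule fundamental_theorem_of_calculus)
      fix s :: real
      have "((\<lambda>s. f (a + s * (x - a))) has_real_derivative deriv f (a + s * (x - a)) * (x - a)) (at s within {0..1})"
        by (rule DERIV_chain2[where f = f]) (use der[of 0] in \<open>auto intro!: derivative_eq_intros\<close>)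
      then show "((\<lambda>s. f (a + s * (x - a))) has_vector_derivative (x - a) * deriv f (a + s * (x - a))) (at s within {0..1})"
        by (simp add: has_real_derivative_iff_has_vector_derivative mult.commute)
    qed simp
    then have "((\<lambda>s. (x - a) * deriv f (a + s * (x - a))) has_integral f x) {0..1}"
      using \<open>f a = 0\<close> by simp
    then have "integral {0..1} (\<lambda>s. (x - a) * deriv f (a + s * (x - a))) = f x"
      by (rule integral_unique)
    then show ?thesis by (simp add: h_def)
  qed
  moreover have "(deriv ^^ k) (h 0) a = (deriv ^^ Suc k) f a / real (Suc k)" for k
  proof -
    have "((\<lambda>s::real. s ^ k) has_integral (1 / real (Suc k) - 0)) {0..1}"
    proof -
      have "((\<lambda>s::real. s ^ k) has_integral (1 ^ Suc k / real (Suc k) - 0 ^ Suc k / real (Suc k))) {0..1}"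
      proof (rule fundamental_theorem_of_calculus)
        fix s :: real
        have "((\<lambda>s. s ^ Suc k / real (Suc k)) has_real_derivative
            (real (Suc k) * (1 * s ^ (Suc k - Suc 0))) / real (Suc k)) (at s within {0..1})"
          by (intro DERIV_cdivide DERIV_power DERIV_ident)
        then show "((\<lambda>s. s ^ Suc k / real (Suc k)) has_vector_derivative s ^ k) (at s within {0..1})"
          by (simp add: has_real_derivative_iff_has_vector_derivative del: power_Suc of_nat_Suc)
      qed simp
      then show ?thesis by simp
    qed
    then have "integral {0..1} (\<lambda>s::real. s ^ k) = 1 / real (Suc k)" by (simp add: integral_unique)
    then show ?thesis
      by (simp add: deriv_tower(1)[of h, OF hd] h_def)
  qed
  ultimately show ?thesis using that deriv_tower(2)[of h, OF hd] by blast
qed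

text \<open>The derivative formula in \<open>hadamard_division\<close> shows that the quotient
  vanishes to one order less at a, so the division can be repeated m times.\<close>

lemma smooth_zero_factor:
  assumes "smooth_on UNIV f" "\<And>j. j < m \<Longrightarrow> (deriv ^^ j) f a = 0" "(deriv ^^ m) f a \<noteq> 0"
  obtains h where "smooth_on UNIV h" "\<And>x. f x = (x - a) ^ m * h x" "h a \<noteq> 0"
  using assms
proof (induction m arbitrary: f thesis)
  case 0
  show ?case by (rule 0(1)[of f]) (use 0 in auto)
next
  case (Suc m)
  have "f a = 0" using Suc.prems(3)[of 0] by simp
  from hadamard_division[OF Suc.prems(2) this] obtain h where h: "smooth_on UNIV h"
    "\<And>x. f x = (x - a) * h x" "\<And>k. (deriv ^^ k) h a = (deriv ^^ Suc k) f a / real (Suc k)" by blast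
  have "\<And>j. j < m \<Longrightarrow> (deriv ^^ j) h a = 0" "(deriv ^^ m) h a \<noteq> 0"
    using Suc.prems(3)[of "Suc _"] Suc.prems(4) by (auto simp: h(3) simp del: funpow.simps)
  with Suc.IH[OF _ h(1)] obtain k where "smooth_on UNIV k" "\<And>x. h x = (x - a) ^ m * k x" "k a \<noteq> 0"
    by blast
  with Suc.prems(1)[of k] h(2) show ?case by (simp add: mult_ac)
qed

subsection \<open>From the multiplier to a trigonometric polynomial\<close>

lemma periodic_int:
  fixes f :: "real \<Rightarrow> 'a"
  assumes "\<And>x. f (x + 2 * pi) = f x"
  shows "f (x + of_int j * (2 * pi)) = f x"
proof (induction j rule: int_induct[where k = 0])
  case (step1 i)
  then show ?case using assms[of "x + of_int i * (2 * pi)"] by (simp add: algebra_simps)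
next
  case (step2 i)
  then show ?case using assms[of "x + of_int (i - 1) * (2 * pi)"] by (simp add: algebra_simps)
qed simp

lemma deriv_funpow_shift:
  fixes f :: "real \<Rightarrow> real"
  shows "(deriv ^^ k) (\<lambda>x. f (x + a)) = (\<lambda>x. (deriv ^^ k) f (x + a))"
proof (induction k)
  case (Suc k)
  have "deriv (\<lambda>x. g (x + a)) x = deriv g (x + a)" for g :: "real \<Rightarrow> real" and x
    unfolding deriv_def by (simp add: DERIV_shift)
  then show ?case using Suc by simp
qed simp

lemma sin_half_zero_iff: "sin ((y - x) / 2) = 0 \<longleftrightarrow> (\<exists>j::int. y = x + of_int j * (2 * pi))"
  by (auto simp: sin_zero_iff_int2 field_simps)

lemma periodic_representative:
  obtains x and j :: int where "x \<in> {0..<2 * pi}" "y = x + of_int j * (2 * pi)"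
proof -
  define j where "j = \<lfloor>y / (2 * pi)\<rfloor>"
  have "of_int j \<le> y / (2 * pi)" "y / (2 * pi) < of_int j + 1" unfolding j_def by linarith+
  then have "of_int j * (2 * pi) \<le> y" "y < (of_int j + 1) * (2 * pi)"
    by (simp_all add: field_simps)
  then have "y - of_int j * (2 * pi) \<in> {0..<2 * pi}" by (simp add: algebra_simps)
  then show ?thesis using that[of "y - of_int j * (2 * pi)" j] by simp
qed

lemma representative_unique:
  assumes "x \<in> {0..<2 * pi}" "x' \<in> {0..<2 * pi}" "x' = x + of_int j * (2 * pi)"
  shows "x = x'"
proof -
  have "\<bar>of_int j * (2 * pi)\<bar> < 2 * pi" using assms by auto
  then have "\<bar>real_of_int j\<bar> * (2 * pi) < 1 * (2 * pi)" by (simp add: abs_mult)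
  then have "\<bar>real_of_int j\<bar> < 1" using pi_gt_zero by (simp only: mult_less_cancel_right)
  then have "j = 0" by linarith
  then show ?thesis using assms by simp
qed

section \<open>Comparison of the multiplier g with a product p of half-angle sines having the same
  zeros\<close>

context
  fixes g p :: "real \<Rightarrow> real" and S :: "real set" and m :: nat
  assumes g: "g \<in> smooth_circle" and zc: "circle_zero_count g m"
    and S_eq: "S = {x \<in> {0..<2 * pi}. g x = 0}"
    and p_eq: "p = (\<lambda>t. \<Prod>x\<in>S. sin ((t - x) / 2) ^ zero_mult g x)"
begin

lemma finS: "finite S" and finite_order: "g x = 0 \<Longrightarrow> \<exists>k. (deriv ^^ k) g x \<noteq> 0"
  and sum_mult: "(\<Sum>x\<in>S. zero_mult g x) = m"
  using zc by (auto simp: circle_zero_count_def S_eq)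

lemma g_per: "g (x + 2 * pi) = g x" and g_smooth: "smooth_on UNIV g"
  using g by (auto simp: smooth_circle_iff)

lemma zero_mult_periodic: "zero_mult g (x + of_int j * (2 * pi)) = zero_mult g x"
proof (rule periodic_int)
  fix x
  have "(deriv ^^ k) g (x + 2 * pi) = (deriv ^^ k) g x" for k
    using deriv_funpow_shift[of k g "2 * pi"] g_per by (simp add: fun_eq_iff)
  then show "zero_mult g (x + 2 * pi) = zero_mult g x" by (simp add: zero_mult_def)
qed

lemma smooth_p: "smooth_on UNIV p"
  unfolding p_eq by (intro smooth_on_prod smooth_on_power smooth_sin_half) auto

lemma zero_mult_pos: "g x = 0 \<Longrightarrow> zero_mult g x > 0"
  using LeastI_ex[OF finite_order[of x]] by (auto simp: zero_mult_def[symmetric] intro!: gr0I)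

lemma p_zero_iff: "p y = 0 \<longleftrightarrow> g y = 0"
proof
  assume "p y = 0"
  then obtain x where "x \<in> S" "sin ((y - x) / 2) = 0" using finS by (auto simp: p_eq)
  then obtain j :: int where "y = x + of_int j * (2 * pi)" by (auto simp: sin_half_zero_iff)
  then show "g y = 0" using periodic_int[of g, OF g_per] \<open>x \<in> S\<close> by (auto simp: S_eq)
next
  assume "g y = 0"
  obtain x and j :: int where x: "x \<in> {0..<2 * pi}" "y = x + of_int j * (2 * pi)"
    by (rule periodic_representative)
  then have "g x = 0" using periodic_int[of g, OF g_per] \<open>g y = 0\<close> by simp
  then have "x \<in> S" "zero_mult g x > 0" using x zero_mult_pos by (auto simp: S_eq)
  moreover have "sin ((y - x) / 2) = 0" using x sin_half_zero_iff by blast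
  ultimately show "p y = 0" using finS by (auto simp: p_eq intro!: bexI[of _ x])
qed

text \<open>Near a zero y both functions are (t - y)^mu times a nonvanishing smooth function, and k
  is the quotient of these. For g this is \<open>smooth_zero_factor\<close>; in p exactly one sine
  vanishes at y. The last clause, that zeros are isolated, later determines the quotient at y as a
  limit.\<close>

lemma local_quotient:
  obtains k U where "open U" "y \<in> U" "smooth_on U k" "\<And>t. t \<in> U \<Longrightarrow> k t \<noteq> 0"
    "\<And>t. t \<in> U \<Longrightarrow> p t = k t * g t" "\<And>t. t \<in> U \<Longrightarrow> t \<noteq> y \<Longrightarrow> g t \<noteq> 0"
proof (cases "g y = 0")
  case False
  define U where "U = {t. g t \<noteq> 0}"
  have "open U" unfolding U_def
    by (intro open_Collect_neq continuous_on_const continuous_at_imp_continuous_on)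
       (use smooth_on_imp_continuous[OF g_smooth] in auto)
  moreover have "smooth_on U (\<lambda>t. p t * inverse (g t))"
    by (intro smooth_on_mult smooth_on_inverse smooth_on_subset[OF smooth_p] smooth_on_subset[OF g_smooth] \<open>open U\<close>)
       (auto simp: U_def)
  ultimately show ?thesis
    by (intro that[of U "\<lambda>t. p t * inverse (g t)"]) (use False p_zero_iff in \<open>auto simp: U_def\<close>)
next
  case True
  obtain x and j :: int where x: "x \<in> {0..<2 * pi}" "y = x + of_int j * (2 * pi)"
    by (rule periodic_representative)
  have xS: "x \<in> S" using periodic_int[of g, OF g_per] True x by (simp add: S_eq)
  define \<mu> where "\<mu> = zero_mult g x"
  have \<mu>: "\<mu> = zero_mult g y" using zero_mult_periodic x by (simp add: \<mu>_def)
  have "(deriv ^^ \<mu>) g y \<noteq> 0" "\<And>j. j < \<mu> \<Longrightarrow> (deriv ^^ j) g y = 0"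
    using LeastI_ex[OF finite_order[OF True]] not_less_Least unfolding \<mu> zero_mult_def by blast+
  from smooth_zero_factor[OF g_smooth this(2,1)] obtain h where
    h: "smooth_on UNIV h" "\<And>t. g t = (t - y) ^ \<mu> * h t" "h y \<noteq> 0" by blast
  have sin0: "sin ((y - x) / 2) = 0" using x sin_half_zero_iff by blast
  from hadamard_division[OF smooth_sin_half this] obtain s where s: "smooth_on UNIV s"
    "\<And>t. sin ((t - x) / 2) = (t - y) * s t"
    "\<And>k. (deriv ^^ k) s y = (deriv ^^ Suc k) (\<lambda>t. sin ((t - x) / 2)) y / real (Suc k)" by blast
  \<comment> \<open>The zero of the sine is simple: the derivative is half a cosine, taken where the
    sine vanishes.\<close>
  have "((\<lambda>t. sin ((t - x) / 2)) has_real_derivative cos ((y - x) / 2) / 2) (at y)"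
    by (auto intro!: derivative_eq_intros)
  then have "s y = cos ((y - x) / 2) / 2" using s(3)[of 0] by (simp add: DERIV_imp_deriv)
  then have sy: "s y \<noteq> 0" using sin0 sin_cos_squared_add[of "(y - x) / 2"] by auto
  define r where "r = (\<lambda>t. \<Prod>x'\<in>S - {x}. sin ((t - x') / 2) ^ zero_mult g x')"
  have r_smooth: "smooth_on UNIV r"
    unfolding r_def by (intro smooth_on_prod smooth_on_power smooth_sin_half) auto
  \<comment> \<open>A second sine vanishing at y would belong to another point of [0, 2 pi)
    congruent to x modulo 2 pi.\<close>
  have ry: "r y \<noteq> 0"
  proof
    assume "r y = 0"
    then obtain x' where x': "x' \<in> S" "x' \<noteq> x" "sin ((y - x') / 2) = 0" using finS by (auto simp: r_def)
    then obtain i :: int where "y = x' + of_int i * (2 * pi)" by (auto simp: sin_half_zero_iff)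
    then have "x' = x + of_int (j - i) * (2 * pi)" using x by (simp add: algebra_simps)
    moreover have "x' \<in> {0..<2 * pi}" using x' by (simp add: S_eq)
    ultimately have "x = x'" by (intro representative_unique[OF x(1), of x' "j - i"])
    then show False using x'(2) by simp
  qed
  have p_fact: "p t = (t - y) ^ \<mu> * s t ^ \<mu> * r t" for t
    unfolding p_eq r_def using prod.remove[OF finS xS, of "\<lambda>x. sin ((t - x) / 2) ^ zero_mult g x"]
    by (simp add: s(2) \<mu>_def power_mult_distrib)
  define U where "U = {t. h t * s t * r t \<noteq> 0}"
  have cont: "continuous_on UNIV f" if "smooth_on UNIV f" for f
    using smooth_on_imp_continuous[OF that] by (simp add: continuous_at_imp_continuous_on)
  note [continuous_intros] = cont[OF h(1)] cont[OF s(1)] cont[OF r_smooth]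
  have "open U" unfolding U_def by (intro open_Collect_neq continuous_intros)
  show ?thesis
  proof (rule that[of U "\<lambda>t. s t ^ \<mu> * r t * inverse (h t)"])
    show "smooth_on U (\<lambda>t. s t ^ \<mu> * r t * inverse (h t))"
      by (intro smooth_on_mult smooth_on_power smooth_on_inverse \<open>open U\<close> smooth_on_subset[OF s(1)]
            smooth_on_subset[OF r_smooth] smooth_on_subset[OF h(1)]) (auto simp: U_def)
    show "y \<in> U" using sy ry h(3) by (simp add: U_def)
    fix t assume "t \<in> U"
    then have nz: "h t \<noteq> 0" "s t \<noteq> 0" "r t \<noteq> 0" by (auto simp: U_def)
    then show "s t ^ \<mu> * r t * inverse (h t) \<noteq> 0" by simp
    have "s t ^ \<mu> * r t * inverse (h t) * g t = (t - y) ^ \<mu> * s t ^ \<mu> * r t * (inverse (h t) * h t)"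
      by (subst h(2)) (simp only: mult_ac)
    then show "p t = s t ^ \<mu> * r t * inverse (h t) * g t"
      using nz by (subst p_fact) simp
    show "g t \<noteq> 0" if "t \<noteq> y" using nz that h(2)[of t] by simp
  qed (rule \<open>open U\<close>)
qed

text \<open>Setting Q to the limit of p/g at a zero makes it agree with every local quotient, so
  smoothness and nonvanishing are inherited from them. Periodicity holds off the zeros and extends
  to them by continuity.\<close>

lemma global_quotient:
  obtains Q where "smooth_on UNIV Q" "\<And>t. Q t \<noteq> 0" "\<And>t. p t = Q t * g t"
    "\<And>t. even m \<Longrightarrow> Q (t + 2 * pi) = Q t"
proof -
  define Q where "Q t = (if g t \<noteq> 0 then p t / g t else Lim (at t) (\<lambda>s. p s / g s))" for t
  have loc: "\<exists>U k. open U \<and> y \<in> U \<and> smooth_on U k \<and> (\<forall>t\<in>U. k t \<noteq> 0 \<and> p t = k t * g t \<and> Q t = k t \<and> (t \<noteq> y \<longrightarrow> g t \<noteq> 0))" for y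
  proof -
    obtain k U where k: "open U" "y \<in> U" "smooth_on U k" "\<And>t. t \<in> U \<Longrightarrow> k t \<noteq> 0"
      "\<And>t. t \<in> U \<Longrightarrow> p t = k t * g t" "\<And>t. t \<in> U \<Longrightarrow> t \<noteq> y \<Longrightarrow> g t \<noteq> 0"
      by (rule local_quotient[of y]) (rule that; assumption)
    have "Q t = k t" if "t \<in> U" for t
    proof (cases "g t = 0")
      case True
      then have "t = y" using k(6) that by blast
      have "eventually (\<lambda>s. s \<in> U) (at y)" using k(1,2) by (rule eventually_at_in_open')
      then have "eventually (\<lambda>s. k s = p s / g s) (at y)"
        unfolding eventually_at_filter by eventually_elim (use k(5,6) in auto)
      moreover have "(k \<longlongrightarrow> k y) (at y)"
        using smooth_on_imp_continuous[OF k(3,2)] by (simp add: isCont_def)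
      ultimately have "((\<lambda>s. p s / g s) \<longlongrightarrow> k y) (at y)"
        by (rule Lim_transform_eventually[rotated])
      then have "Lim (at y) (\<lambda>s. p s / g s) = k y" by (intro tendsto_Lim) auto
      then show ?thesis using True \<open>t = y\<close> by (simp add: Q_def)
    qed (use k(5)[OF that] in \<open>simp add: Q_def\<close>)
    with k show ?thesis by (intro exI[of _ U] exI[of _ k]) simp
  qed
  have Q_smooth: "smooth_on UNIV Q"
  proof (rule smooth_on_locally)
    fix y
    obtain U k where U: "open U" "y \<in> U" "smooth_on U k" "\<forall>t\<in>U. Q t = k t"
      using loc[of y] by blast
    then have "smooth_on U Q" using smooth_on_cong[OF U(1,3), of Q] by simp
    with U show "\<exists>U. y \<in> U \<and> smooth_on U Q" by blast
  qed
  have "Q (t + 2 * pi) = Q t" if "even m" for t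
  proof -
    \<comment> \<open>Each of the m sines changes sign under a full turn, and m is even.\<close>
    have p_per: "p (s + 2 * pi) = p s" for s
    proof -
      have "sin ((s + 2 * pi - x) / 2) = - sin ((s - x) / 2)" for x
        using sin_periodic_pi[of "(s - x) / 2"] by (simp add: field_simps)
      then have "p (s + 2 * pi) = (\<Prod>x\<in>S. (-1) ^ zero_mult g x * sin ((s - x) / 2) ^ zero_mult g x)"
        unfolding p_eq by (simp only: power_minus[of "sin _"])
      also have "\<dots> = (-1) ^ m * p s"
        by (simp add: prod.distrib p_eq sum_mult flip: power_sum)
      finally show ?thesis using that by simp
    qed
    obtain U where U: "open U" "t \<in> U" "\<And>s. s \<in> U \<Longrightarrow> s \<noteq> t \<Longrightarrow> g s \<noteq> 0"
      using loc[of t] by blast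
    have "eventually (\<lambda>s. s \<in> U) (at t)" using U(1,2) by (rule eventually_at_in_open')
    then have "eventually (\<lambda>s. Q s = Q (s + 2 * pi)) (at t)"
      unfolding eventually_at_filter
      by eventually_elim (use U(3) in \<open>auto simp: Q_def g_per p_per\<close>)
    moreover have "(Q \<longlongrightarrow> Q t) (at t)"
      using smooth_on_imp_continuous[OF Q_smooth] by (simp add: isCont_def)
    ultimately have "((\<lambda>s. Q (s + 2 * pi)) \<longlongrightarrow> Q t) (at t)"
      by (rule Lim_transform_eventually[rotated])
    moreover have "isCont (\<lambda>s. Q (s + 2 * pi)) t"
      by (rule isCont_o2[where g = Q]) (use smooth_on_imp_continuous[OF Q_smooth] in auto)
    then have "((\<lambda>s. Q (s + 2 * pi)) \<longlongrightarrow> Q (t + 2 * pi)) (at t)" by (simp add: isCont_def)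
    ultimately show ?thesis using tendsto_unique[OF at_neq_bot] by blast
  qed
  moreover have "Q t \<noteq> 0" "p t = Q t * g t" for t using loc[of t] by auto
  ultimately show ?thesis using Q_smooth by (intro that[of Q]) simp_all
qed

end

text \<open>Lists every point of S as often as its multiplicity. One enumeration serves all
  \<open>F\<close>, so the zeros become an indexed family with repetitions that does not depend on
  the variable of the sines.\<close>

lemma prod_power_as_indexed_prod:
  fixes F :: "'a \<Rightarrow> 'b :: comm_monoid_mult"
  assumes "finite S"
  shows "\<exists>\<theta> :: nat \<Rightarrow> 'a. \<forall>F :: 'a \<Rightarrow> 'b. (\<Prod>x\<in>S. F x ^ \<mu> x) = (\<Prod>j<(\<Sum>x\<in>S. \<mu> x). F (\<theta> j))"
  using assms
proof (induction S)
  case (insert x S)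
  obtain \<theta> where \<theta>: "\<And>F :: 'a \<Rightarrow> 'b. (\<Prod>x\<in>S. F x ^ \<mu> x) = (\<Prod>j<(\<Sum>x\<in>S. \<mu> x). F (\<theta> j))"
    using insert.IH by blast
  define \<theta>' where "\<theta>' j = (if j < (\<Sum>x\<in>S. \<mu> x) then \<theta> j else x)" for j
  have "(\<Prod>y\<in>insert x S. F y ^ \<mu> y) = (\<Prod>j<(\<Sum>x\<in>insert x S. \<mu> x). F (\<theta>' j))" for F :: "'a \<Rightarrow> 'b"
  proof -
    have *: "(\<Prod>j<a + b. F (if j < a then \<theta> j else x)) = (\<Prod>j<a. F (\<theta> j)) * F x ^ b" for a b
      by (induction b) (auto simp: mult_ac)
    show ?thesis using insert.hyps \<theta>[of F] *[of "\<Sum>x\<in>S. \<mu> x" "\<mu> x"]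
      by (simp add: \<theta>'_def mult_ac add_ac)
  qed
  then show ?case by blast
qed simp

lemma almost_changes_sign_trig:
  assumes "almost_changes_sign T m" "even m"
  obtains \<theta> :: "nat \<Rightarrow> real" and \<sigma> :: real
  where "\<bar>\<sigma>\<bar> = 1" "(\<lambda>t. \<sigma> * (\<Prod>j<m. sin ((t - \<theta> j) / 2))) \<in> smooth_circle"
    "\<And>f. f \<in> smooth_circle \<Longrightarrow> (\<And>x. f x \<ge> 0) \<Longrightarrow>
       T (\<lambda>t. (\<sigma> * (\<Prod>j<m. sin ((t - \<theta> j) / 2))) * f t) \<ge> 0"
proof -
  obtain g where g: "g \<in> smooth_circle" "circle_zero_count g m"
    and pos: "\<And>f. f \<in> smooth_circle \<Longrightarrow> (\<And>x. f x \<ge> 0) \<Longrightarrow> T (\<lambda>x. g x * f x) \<ge> 0"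
    using assms(1) unfolding almost_changes_sign_def by blast
  define S where "S = {x \<in> {0..<2 * pi}. g x = 0}"
  have S: "finite S" "(\<Sum>x\<in>S. zero_mult g x) = m" using g(2) by (auto simp: circle_zero_count_def S_def)
  obtain \<theta> where \<theta>: "\<And>F :: real \<Rightarrow> real. (\<Prod>x\<in>S. F x ^ zero_mult g x) = (\<Prod>j<m. F (\<theta> j))"
    using prod_power_as_indexed_prod[OF S(1), of "zero_mult g"] S(2) by metis
  define p where "p = (\<lambda>t. \<Prod>x\<in>S. sin ((t - x) / 2) ^ zero_mult g x)"
  have p: "p t = (\<Prod>j<m. sin ((t - \<theta> j) / 2))" for t
    unfolding p_def using \<theta>[of "\<lambda>x. sin ((t - x) / 2)"] .
  obtain Q where Q: "smooth_on UNIV Q" "\<And>t. Q t \<noteq> 0" "\<And>t. p t = Q t * g t"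
    and Qper: "\<And>t. Q (t + 2 * pi) = Q t"
    by (rule global_quotient[OF g S_def p_def]) (use assms(2) in blast)
  have Qc: "Q \<in> smooth_circle" using Q Qper by (simp add: smooth_circle_iff)
  have "(\<forall>t. Q t > 0) \<or> (\<forall>t. Q t < 0)"
  proof (rule ccontr)
    assume "\<not> ?thesis"
    then obtain s t where "Q s \<le> 0" "Q t \<ge> 0" by (auto simp: not_less)
    moreover have "connected (range Q)"
      by (intro connected_continuous_image continuous_at_imp_continuous_on)
         (use smooth_on_imp_continuous[OF Q(1)] in auto)
    ultimately have "0 \<in> range Q" using connectedD_interval[of "range Q" "Q s" "Q t" 0] by blast
    then show False using Q(2) by auto
  qed
  then obtain \<sigma> :: real where \<sigma>: "\<bar>\<sigma>\<bar> = 1" "\<And>t. \<sigma> * Q t \<ge> 0"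
  proof
    assume "\<forall>t. Q t > 0" then show ?thesis using that[of 1] by (simp add: less_imp_le)
  next
    assume "\<forall>t. Q t < 0" then show ?thesis using that[of "-1"] by (simp add: less_imp_le)
  qed
  show ?thesis
  proof (rule that[of \<sigma> \<theta>])
    show "(\<lambda>t. \<sigma> * (\<Prod>j<m. sin ((t - \<theta> j) / 2))) \<in> smooth_circle"
      unfolding p[symmetric] Q(3) by (intro smooth_circle_mult smooth_circle_const Qc g(1))
  next
    fix f assume f: "f \<in> smooth_circle" "\<And>x. f x \<ge> 0"
    \<comment> \<open>As p = Q g, testing against sigma p f is the same as testing g against the
      nonnegative function sigma Q f.\<close>
    have "T (\<lambda>x. g x * (\<sigma> * Q x * f x)) \<ge> 0"
      by (intro pos smooth_circle_mult smooth_circle_const f Qc mult_nonneg_nonneg \<sigma>)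
    also have "(\<lambda>x. g x * (\<sigma> * Q x * f x)) = (\<lambda>t. (\<sigma> * (\<Prod>j<m. sin ((t - \<theta> j) / 2))) * f t)"
      unfolding p[symmetric] Q(3) by (simp add: mult_ac)
    finally show "T (\<lambda>t. (\<sigma> * (\<Prod>j<m. sin ((t - \<theta> j) / 2))) * f t) \<ge> 0" .
  qed (fact \<sigma>)
qed

subsection \<open>Fourier coefficients of positive functionals\<close>

definition linear_functional :: "((real \<Rightarrow> real) \<Rightarrow> real) \<Rightarrow> bool" where
  "linear_functional L \<longleftrightarrow>
     (\<forall>f \<in> smooth_circle. \<forall>g \<in> smooth_circle. L (\<lambda>x. f x + g x) = L f + L g) \<and>
     (\<forall>f \<in> smooth_circle. \<forall>c. L (\<lambda>x. c * f x) = c * L f)"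

definition complex_smooth :: "(real \<Rightarrow> complex) \<Rightarrow> bool" where
  "complex_smooth F \<longleftrightarrow> (\<lambda>t. Re (F t)) \<in> smooth_circle \<and> (\<lambda>t. Im (F t)) \<in> smooth_circle"

definition complexify :: "((real \<Rightarrow> real) \<Rightarrow> real) \<Rightarrow> (real \<Rightarrow> complex) \<Rightarrow> complex" where
  "complexify L F = Complex (L (\<lambda>t. Re (F t))) (L (\<lambda>t. Im (F t)))"

text \<open>There is no factor 1/(2 pi): a point mass M at tau has the coefficients M e^{-i k tau},
  and coefficient 0 of a positive functional is its total mass.\<close>

definition fourier :: "((real \<Rightarrow> real) \<Rightarrow> real) \<Rightarrow> int \<Rightarrow> complex" where
  "fourier L k = complexify L (\<lambda>t. cis (- (of_int k * t)))"

lemma circle_distribution_linear: "circle_distribution T \<Longrightarrow> linear_functional T"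
  by (simp add: circle_distribution_def linear_functional_def)

lemma linear_functional_weighted:
  assumes "linear_functional T" "p \<in> smooth_circle"
  shows "linear_functional (\<lambda>f. T (\<lambda>t. p t * f t))"
proof -
  have "T (\<lambda>t. p t * (f t + g t)) = T (\<lambda>t. p t * f t) + T (\<lambda>t. p t * g t)"
    if "f \<in> smooth_circle" "g \<in> smooth_circle" for f g
    using assms that smooth_circle_mult[OF assms(2)]
    by (simp add: linear_functional_def distrib_left)
  moreover have "T (\<lambda>t. p t * (c * f t)) = c * T (\<lambda>t. p t * f t)" if "f \<in> smooth_circle" for f c
    using assms that smooth_circle_mult[OF assms(2)]
    by (simp add: linear_functional_def mult.left_commute)
  ultimately show ?thesis by (simp add: linear_functional_def)
qed

lemma smooth_circle_cos: "(\<lambda>t. cos (of_int k * t + a)) \<in> smooth_circle"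
proof -
  define h where "h j t = real_of_int k ^ j * cos (of_int k * t + a + real j * (pi / 2))" for j :: nat and t
  have "(h j has_real_derivative h (Suc j) t) (at t)" for j t
  proof -
    have "cos (of_int k * t + a + real (Suc j) * (pi / 2)) = - sin (of_int k * t + a + real j * (pi / 2))"
      using cos_add[of "of_int k * t + a + real j * (pi / 2)" "pi / 2"]
      by (simp add: algebra_simps add_divide_distrib)
    moreover have "(h j has_real_derivative of_int k ^ j * (- sin (of_int k * t + a + real j * (pi / 2)) * of_int k)) (at t)"
      unfolding h_def by (auto intro!: derivative_eq_intros)
    ultimately show ?thesis by (simp add: h_def mult_ac)
  qed
  moreover have "h 0 (t + 2 * pi) = h 0 t" for t
  proof -
    have "cos (real_of_int k * (t + 2 * pi) + a) = cos (real_of_int k * t + a + 2 * pi * of_int k)"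
      by (simp add: algebra_simps)
    also have "\<dots> = cos (real_of_int k * t + a)"
      using cos_int_2pin[of k] sin_int_2pin[of k] by (simp only: cos_add mult_1_right mult_zero_right diff_zero)
    finally show ?thesis by (simp add: h_def)
  qed
  ultimately have "h 0 \<in> smooth_circle" by (rule smooth_circle_tower)
  then show ?thesis by (simp add: h_def [abs_def])
qed

lemma complex_smooth_cis: "complex_smooth (\<lambda>t. cis (of_int k * t))"
  using smooth_circle_cos[of k 0] smooth_circle_cos[of k "- (pi / 2)"]
  by (simp add: complex_smooth_def cos_diff)

lemma complex_smooth_cis_neg: "complex_smooth (\<lambda>t. cis (- (of_int k * t)))"
  using complex_smooth_cis[of "- k"] by simp

lemma complex_smooth_scale: "complex_smooth F \<Longrightarrow> complex_smooth (\<lambda>t. c * F t)"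
  using smooth_circle_add[OF smooth_circle_scale smooth_circle_scale, of _ _ "Re c" "Im c"]
    smooth_circle_add[OF smooth_circle_scale smooth_circle_scale, of _ _ "Re c" "- Im c"]
  by (simp add: complex_smooth_def)

lemma complex_smooth_sum: "(\<And>i. i \<in> A \<Longrightarrow> complex_smooth (F i)) \<Longrightarrow> complex_smooth (\<lambda>t. \<Sum>i\<in>A. F i t)"
  by (induction A rule: infinite_finite_induct)
     (auto simp: complex_smooth_def smooth_circle_const intro: smooth_circle_add)

lemma smooth_circle_rotated_cos: "(\<lambda>t. c - d * cos (of_int k * (t - \<tau>))) \<in> smooth_circle"
  using smooth_circle_add[OF smooth_circle_const smooth_circle_scale[OF smooth_circle_cos], of c "- d" k "- (of_int k * \<tau>)"]
  by (simp add: right_diff_distrib)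

text \<open>Since 1 - cos y = 2 sin^2(y/2), this is the square of |sin k y| <= k |sin y|, which
  follows by induction from the addition formula.\<close>

lemma one_minus_cos_mult_le: "1 - cos (real k * x) \<le> (real k)\<^sup>2 * (1 - cos x)"
proof -
  have "\<bar>sin (real k * y)\<bar> \<le> real k * \<bar>sin y\<bar>" for y
  proof (induction k)
    case (Suc k)
    have "sin (real (Suc k) * y) = sin (real k * y) * cos y + cos (real k * y) * sin y"
      using sin_add[of "real k * y" y] by (simp add: algebra_simps)
    then have "\<bar>sin (real (Suc k) * y)\<bar> \<le> \<bar>sin (real k * y)\<bar> * \<bar>cos y\<bar> + \<bar>cos (real k * y)\<bar> * \<bar>sin y\<bar>"
      using abs_triangle_ineq[of "sin (real k * y) * cos y" "cos (real k * y) * sin y"]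
      by (simp only: abs_mult)
    also have "\<dots> \<le> \<bar>sin (real k * y)\<bar> * 1 + 1 * \<bar>sin y\<bar>"
      by (intro add_mono mult_mono) auto
    finally show ?case using Suc by (simp add: algebra_simps)
  qed simp
  from power_mono[OF this, of "x / 2" 2]
  have "(sin (real k * (x / 2)))\<^sup>2 \<le> (real k * \<bar>sin (x / 2)\<bar>)\<^sup>2" by simp
  moreover have "1 - cos y = 2 * (sin (y / 2))\<^sup>2" for y :: real
    using cos_double_sin[of "y / 2"] by simp
  ultimately show ?thesis by (simp add: power_mult_distrib)
qed

context
  fixes L :: "(real \<Rightarrow> real) \<Rightarrow> real"
  assumes L: "linear_functional L"
begin

lemma functional_add: "f \<in> smooth_circle \<Longrightarrow> g \<in> smooth_circle \<Longrightarrow> L (\<lambda>x. f x + g x) = L f + L g"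
  and functional_scale: "f \<in> smooth_circle \<Longrightarrow> L (\<lambda>x. c * f x) = c * L f"
  using L by (simp_all add: linear_functional_def)

lemma functional_lincomb:
  assumes "f \<in> smooth_circle" "g \<in> smooth_circle"
  shows "L (\<lambda>t. a * f t + b * g t) = a * L f + b * L g"
  using functional_add[OF smooth_circle_scale[OF assms(1)] smooth_circle_scale[OF assms(2)]]
  by (simp add: functional_scale assms)

lemma functional_zero: "L (\<lambda>x. 0) = 0"
  using functional_scale[of "\<lambda>x. 0" 0] smooth_circle_const[of 0] by simp

lemma complexify_add:
  "complex_smooth F \<Longrightarrow> complex_smooth G \<Longrightarrow> complexify L (\<lambda>t. F t + G t) = complexify L F + complexify L G"
  by (simp add: complexify_def complex_smooth_def functional_add complex_eq_iff)

lemma complexify_scale: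
  assumes "complex_smooth F"
  shows "complexify L (\<lambda>t. c * F t) = c * complexify L F"
proof -
  have F: "(\<lambda>t. Re (F t)) \<in> smooth_circle" "(\<lambda>t. Im (F t)) \<in> smooth_circle"
    using assms by (auto simp: complex_smooth_def)
  show ?thesis
    using functional_lincomb[OF F, of "Re c" "- Im c"] functional_lincomb[OF F(2,1), of "Re c" "Im c"]
    by (simp add: complexify_def complex_eq_iff)
qed

lemma complexify_sum:
  "(\<And>i. i \<in> A \<Longrightarrow> complex_smooth (F i)) \<Longrightarrow>
     complexify L (\<lambda>t. \<Sum>i\<in>A. F i t) = (\<Sum>i\<in>A. complexify L (F i))"
proof (induction A rule: infinite_finite_induct)
  case (insert x A)
  then show ?case by (simp add: complexify_add complex_smooth_sum)
qed (simp_all add: complexify_def functional_zero zero_complex.ctr)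

lemma complexify_trig_poly:
  "complexify L (\<lambda>t. \<Sum>i\<in>A. c i * cis (- (of_int (\<kappa> i) * t))) = (\<Sum>i\<in>A. c i * fourier L (\<kappa> i))"
  by (simp add: complexify_sum complexify_scale complex_smooth_scale complex_smooth_cis_neg fourier_def)

lemma fourier_minus: "fourier L (- k) = cnj (fourier L k)"
proof -
  have "(\<lambda>t. sin (of_int k * t)) \<in> smooth_circle"
    using complex_smooth_cis[of k] by (simp add: complex_smooth_def)
  from functional_scale[OF this, of "-1"] show ?thesis
    by (simp add: fourier_def complexify_def complex_eq_iff)
qed

lemma fourier_rotated_cos:
  "L (\<lambda>t. c - d * cos (of_int k * (t - \<tau>))) = c * Re (fourier L 0) - d * Re (cis (of_int k * \<tau>) * fourier L k)"
proof -
  have f: "(\<lambda>t. cos (of_int k * t)) \<in> smooth_circle" "(\<lambda>t. sin (of_int k * t)) \<in> smooth_circle"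
    using complex_smooth_cis[of k] by (auto simp: complex_smooth_def)
  have g: "(\<lambda>t. - d * cos (of_int k * \<tau>) * cos (of_int k * t) + - d * sin (of_int k * \<tau>) * sin (of_int k * t)) \<in> smooth_circle"
    by (intro smooth_circle_add smooth_circle_scale f)
  have "(\<lambda>t. c - d * cos (of_int k * (t - \<tau>))) =
     (\<lambda>t. c * 1 + 1 * (- d * cos (of_int k * \<tau>) * cos (of_int k * t) + - d * sin (of_int k * \<tau>) * sin (of_int k * t)))"
    by (simp add: right_diff_distrib cos_diff algebra_simps)
  then have "L (\<lambda>t. c - d * cos (of_int k * (t - \<tau>))) =
     L (\<lambda>t. c * 1 + 1 * (- d * cos (of_int k * \<tau>) * cos (of_int k * t) + - d * sin (of_int k * \<tau>) * sin (of_int k * t)))"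
    by simp
  also have "\<dots> = c * L (\<lambda>_. 1) + (- d * cos (of_int k * \<tau>) * L (\<lambda>t. cos (of_int k * t))
      + - d * sin (of_int k * \<tau>) * L (\<lambda>t. sin (of_int k * t)))"
    unfolding functional_lincomb[OF smooth_circle_const g] functional_lincomb[OF f] by simp
  also have "\<dots> = c * Re (fourier L 0) - d * Re (cis (of_int k * \<tau>) * fourier L k)"
  proof -
    have "L (\<lambda>_. 1) = Re (fourier L 0)" "L (\<lambda>t. cos (of_int k * t)) = Re (fourier L k)"
      "L (\<lambda>t. sin (of_int k * t)) = - Im (fourier L k)"
      using functional_scale[OF f(2), of "-1"] by (simp_all add: fourier_def complexify_def)
    then show ?thesis by (simp add: right_diff_distrib)
  qed
  finally show ?thesis .
qed

lemma Im_fourier_0: "Im (fourier L 0) = 0"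
  by (simp add: fourier_def complexify_def functional_zero)

section \<open>Coefficients of positive functionals\<close>

context
  assumes pos: "\<And>f. f \<in> smooth_circle \<Longrightarrow> (\<And>x. f x \<ge> 0) \<Longrightarrow> L f \<ge> 0"
begin

lemma norm_fourier_le: "cmod (fourier L k) \<le> Re (fourier L 0)"
proof (cases "k = 0")
  case True
  have "Re (fourier L 0) \<ge> 0" using pos[of "\<lambda>_. 1"] smooth_circle_const
    by (simp add: fourier_def complexify_def)
  then show ?thesis using True Im_fourier_0 by (simp add: cmod_def)
next
  case False
  \<comment> \<open>This tau rotates the coefficient onto the positive axis, so its real part in the
    test against 1 - cos(k(t - tau)) is its modulus.\<close>
  define \<tau> where "\<tau> = - Arg (fourier L k) / of_int k"
  have "L (\<lambda>t. 1 - 1 * cos (of_int k * (t - \<tau>))) \<ge> 0"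
    by (rule pos[OF smooth_circle_rotated_cos]) simp
  then have "Re (cis (of_int k * \<tau>) * fourier L k) \<le> Re (fourier L 0)"
    unfolding fourier_rotated_cos by simp
  moreover have "cis (of_int k * \<tau>) * fourier L k = cmod (fourier L k)"
  proof -
    have "cis (of_int k * \<tau>) * fourier L k = cis (- Arg (fourier L k)) * rcis (cmod (fourier L k)) (Arg (fourier L k))"
      using False by (simp add: \<tau>_def rcis_cmod_Arg)
    also have "\<dots> = cmod (fourier L k)" by (simp add: rcis_def cis_mult)
    finally show ?thesis .
  qed
  ultimately show ?thesis by simp
qed

text \<open>Equality in the bound for the first coefficient forces a point mass; this is read off from
  $0 \le 1 - \cos k x \le k^2 (1 - \cos x)$.\<close>

lemma fourier_point_mass:
  assumes "fourier L 1 = fourier L 0 * cis (- \<tau>)"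
  shows "fourier L (int k) = fourier L 0 * cis (- \<tau>) ^ k"
proof -
  have real0: "fourier L 0 = of_real (Re (fourier L 0))" using Im_fourier_0 by (simp add: complex_eq_iff)
  \<comment> \<open>The hypothesis on the first coefficient says that the functional annihilates 1 -
    cos(t - tau), here scaled by k^2 to dominate 1 - cos(k(t - tau)).\<close>
  have one: "L (\<lambda>t. (real k)\<^sup>2 - (real k)\<^sup>2 * cos (of_int 1 * (t - \<tau>))) = 0"
  proof -
    have "cis \<tau> * (fourier L 0 * cis (- \<tau>)) = fourier L 0"
      by (subst mult.left_commute) (simp add: cis_mult)
    then show ?thesis
      unfolding fourier_rotated_cos by (simp only: assms of_int_1 mult_1_left diff_self)
  qed
  have fk: "(\<lambda>t. 1 - 1 * cos (of_int (int k) * (t - \<tau>))) \<in> smooth_circle"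
    and f1: "(\<lambda>t. (real k)\<^sup>2 - (real k)\<^sup>2 * cos (of_int 1 * (t - \<tau>))) \<in> smooth_circle"
    by (rule smooth_circle_rotated_cos)+
  have "L (\<lambda>t. ((real k)\<^sup>2 - (real k)\<^sup>2 * cos (of_int 1 * (t - \<tau>))) + - 1 * (1 - 1 * cos (of_int (int k) * (t - \<tau>)))) \<ge> 0"
  proof (rule pos)
    show "0 \<le> ((real k)\<^sup>2 - (real k)\<^sup>2 * cos (of_int 1 * (x - \<tau>))) + - 1 * (1 - 1 * cos (of_int (int k) * (x - \<tau>)))" for x
      using one_minus_cos_mult_le[of k "x - \<tau>"] by (simp add: algebra_simps)
  qed (intro smooth_circle_add smooth_circle_scale fk f1)
  then have "L (\<lambda>t. 1 - 1 * cos (of_int (int k) * (t - \<tau>))) \<le> 0"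
    unfolding functional_add[OF f1 smooth_circle_scale[OF fk]] functional_scale[OF fk] one by simp
  then have *: "Re (cis (of_int (int k) * \<tau>) * fourier L k) \<ge> Re (fourier L 0)"
    unfolding fourier_rotated_cos by simp
  \<comment> \<open>Re z >= nu_0 >= |z| leaves only z = nu_0.\<close>
  define z where "z = cis (of_int (int k) * \<tau>) * fourier L k"
  have "cmod z \<le> Re (fourier L 0)" using norm_fourier_le[of k] by (simp add: z_def norm_mult)
  then have "cmod z \<le> Re z" using * by (simp add: z_def)
  then have "(cmod z)\<^sup>2 \<le> (Re z)\<^sup>2" by (intro power_mono) auto
  then have "Im z = 0" by (simp add: cmod_power2)
  then have "z = of_real (Re z)" by (simp add: complex_eq_iff)
  moreover have "Re z = Re (fourier L 0)"
    using * \<open>cmod z \<le> Re (fourier L 0)\<close> complex_Re_le_cmod[of z] by (simp add: z_def)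
  ultimately have "z = fourier L 0" using real0 by simp
  then have "cis (- (real k * \<tau>)) * z = cis (- (real k * \<tau>)) * fourier L 0" by simp
  then have "fourier L k = cis (- (real k * \<tau>)) * fourier L 0"
    by (simp add: z_def mult.assoc[symmetric] cis_mult)
  moreover have "cis (- \<tau>) ^ k = cis (- (real k * \<tau>))" by (subst Complex.DeMoivre) simp
  ultimately show ?thesis by (simp add: mult.commute)
qed

end

end

subsection \<open>The Poisson extension as a power series\<close>

text \<open>\<open>h j\<close> is the j-th termwise derivative. Decay faster than every power gives
  a convergent majorant for each j, hence uniform convergence. The bound, uniform in t, is what the
  seminorm estimate of a distribution requires.\<close>

lemma rapid_series_derivative:
  fixes c :: "nat \<Rightarrow> complex"
  assumes sm: "\<And>j. summable (\<lambda>k. cmod (c k) * real k ^ j)"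
  defines "h \<equiv> \<lambda>j t. \<Sum>k. Re (c k * (- \<i> * of_nat k) ^ j * cis (- (real k * t)))"
  shows "(h j has_real_derivative h (Suc j) t) (at t)"
    and "summable (\<lambda>k. Re (c k * (- \<i> * of_nat k) ^ j * cis (- (real k * t))))"
    and "\<bar>h j t\<bar> \<le> (\<Sum>k. cmod (c k) * real k ^ j)"
proof -
  define g where "g j k t = Re (c k * (- \<i> * of_nat k) ^ j * cis (- (real k * t)))" for j k t
  have bd: "\<bar>g j k t\<bar> \<le> cmod (c k) * real k ^ j" for j k t
  proof -
    have "\<bar>g j k t\<bar> \<le> cmod (c k * (- \<i> * of_nat k) ^ j * cis (- (real k * t)))"
      unfolding g_def by (rule abs_Re_le_cmod)
    also have "\<dots> = cmod (c k) * real k ^ j" by (simp add: norm_mult norm_power)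
    finally show ?thesis .
  qed
  have sg: "summable (\<lambda>k. \<bar>g j k t\<bar>)" for j t
    by (rule summable_comparison_test'[OF sm[of j], of 0]) (use bd in auto)
  then have sg': "summable (\<lambda>k. g j k t)" for j t by (rule summable_rabs_cancel)
  then show "summable (\<lambda>k. Re (c k * (- \<i> * of_nat k) ^ j * cis (- (real k * t))))"
    by (simp add: g_def)
  have dg: "(g j k has_real_derivative g (Suc j) k t) (at t)" for j k t
  proof -
    have "((\<lambda>t. cis (- (real k * t))) has_vector_derivative (- real k) *\<^sub>R (\<i> * cis (- (real k * t)))) (at t)"
      by (rule vector_diff_chain_at[of "\<lambda>t. - (real k * t)" _ _ cis, unfolded o_def])
         (auto intro!: derivative_eq_intros simp: has_vector_derivative_def)
    then have "((\<lambda>t. c k * (- \<i> * of_nat k) ^ j * cis (- (real k * t))) has_vector_derivative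
       c k * (- \<i> * of_nat k) ^ j * ((- real k) *\<^sub>R (\<i> * cis (- (real k * t))))) (at t)"
      by (rule has_vector_derivative_mult_right)
    then have "((\<lambda>t. Re (c k * (- \<i> * of_nat k) ^ j * cis (- (real k * t)))) has_vector_derivative
       Re (c k * (- \<i> * of_nat k) ^ j * ((- real k) *\<^sub>R (\<i> * cis (- (real k * t)))))) (at t)"
      by (rule bounded_linear.has_vector_derivative[OF bounded_linear_Re])
    moreover have "c k * (- \<i> * of_nat k) ^ j * ((- real k) *\<^sub>R (\<i> * cis (- (real k * t)))) =
        c k * (- \<i> * of_nat k) ^ Suc j * cis (- (real k * t))"
      by (simp add: scaleR_conv_of_real mult_ac)
    ultimately show ?thesis
      by (simp only: g_def [abs_def] has_real_derivative_iff_has_vector_derivative)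
  qed
  have "((\<lambda>t. \<Sum>k. g j k t) has_real_derivative (\<Sum>k. g (Suc j) k t)) (at t)"
  proof (rule has_field_derivative_series'(2)[of UNIV _ _ 0])
    show "uniformly_convergent_on UNIV (\<lambda>n x. \<Sum>i<n. g (Suc j) i x)"
      by (rule Weierstrass_m_test'[OF _ sm[of "Suc j"]]) (simp only: real_norm_def bd)
  qed (use dg sg' in auto)
  then show "(h j has_real_derivative h (Suc j) t) (at t)" by (simp add: h_def g_def [abs_def])
  have "\<bar>\<Sum>k. g j k t\<bar> \<le> (\<Sum>k. \<bar>g j k t\<bar>)" by (rule summable_rabs[OF sg])
  also have "\<dots> \<le> (\<Sum>k. cmod (c k) * real k ^ j)" by (rule suminf_le[OF bd sg sm])
  finally show "\<bar>h j t\<bar> \<le> (\<Sum>k. cmod (c k) * real k ^ j)" by (simp add: h_def g_def)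
qed

lemma rapid_series_smooth:
  fixes c :: "nat \<Rightarrow> complex"
  assumes sm: "\<And>j. summable (\<lambda>k. cmod (c k) * real k ^ j)"
  shows "(\<lambda>t. \<Sum>k. Re (c k * cis (- (real k * t)))) \<in> smooth_circle"
    and "\<bar>(deriv ^^ j) (\<lambda>t. \<Sum>k. Re (c k * cis (- (real k * t)))) t\<bar> \<le> (\<Sum>k. cmod (c k) * real k ^ j)"
proof -
  define h where "h = (\<lambda>j t. \<Sum>k. Re (c k * (- \<i> * of_nat k) ^ j * cis (- (real k * t))))"
  have h: "(h j has_real_derivative h (Suc j) t) (at t)" "\<bar>h j t\<bar> \<le> (\<Sum>k. cmod (c k) * real k ^ j)" for j t
    unfolding h_def by (rule rapid_series_derivative[OF sm])+
  have h0: "h 0 = (\<lambda>t. \<Sum>k. Re (c k * cis (- (real k * t))))" by (simp add: h_def)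
  have "cis (- (real k * (t + 2 * pi))) = cis (- (real k * t))" for k t
  proof -
    have "cis (- (real k * (t + 2 * pi))) = cis (- (real k * t)) * cis (2 * pi * (- of_nat k))"
      by (simp add: cis_mult algebra_simps)
    also have "cis (2 * pi * (- of_nat k)) = 1"
      using cis_multiple_2pi[of "- of_nat k"] by simp
    finally show ?thesis by simp
  qed
  then have "h 0 (t + 2 * pi) = h 0 t" for t by (simp only: h0)
  with smooth_circle_tower[of h, OF h(1)] show "(\<lambda>t. \<Sum>k. Re (c k * cis (- (real k * t)))) \<in> smooth_circle"
    by (simp only: h0)
  show "\<bar>(deriv ^^ j) (\<lambda>t. \<Sum>k. Re (c k * cis (- (real k * t)))) t\<bar> \<le> (\<Sum>k. cmod (c k) * real k ^ j)"
    using deriv_tower(1)[of h, OF h(1), of j] h(2)[where j = j and t = t] by (simp only: h0)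
qed

text \<open>T may be applied termwise because the continuity estimate controls the tail: it involves
  finitely many seminorms, each bounded by the tail of a convergent series.\<close>

lemma distribution_rapid_series_Re:
  fixes c :: "nat \<Rightarrow> complex"
  assumes T: "circle_distribution T" and sm: "\<And>j. summable (\<lambda>k. cmod (c k) * real k ^ j)"
  shows "(\<lambda>k. Re (c k * fourier T (int k))) sums T (\<lambda>t. \<Sum>k. Re (c k * cis (- (real k * t))))"
proof -
  note lin = circle_distribution_linear[OF T]
  obtain C N where CN: "\<And>f. f \<in> smooth_circle \<Longrightarrow> \<bar>T f\<bar> \<le> C * (\<Sum>k\<le>N. SUP x. \<bar>(deriv ^^ k) f x\<bar>)"
    using T unfolding circle_distribution_def by blast
  define f where "f = (\<lambda>t. \<Sum>k. Re (c k * cis (- (real k * t))))"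
  define head where "head K = (\<lambda>t. Re (\<Sum>k<K. c k * cis (- (of_int (int k) * t))))" for K :: nat
  \<comment> \<open>Cutting off the first K coefficients keeps the tail a series of the same form,
    to which the smoothness and derivative bounds apply again.\<close>
  define ct where "ct K k = (if k < K then 0 else c k)" for K k :: nat
  define tail where "tail K = (\<lambda>t. \<Sum>k. Re (ct K k * cis (- (real k * t))))" for K
  define M where "M j K = (\<Sum>k. cmod (ct K k) * real k ^ j)" for j K
  have "cmod (ct K k) * real k ^ j \<le> cmod (c k) * real k ^ j" for K k j by (simp add: ct_def)
  then have smt: "summable (\<lambda>k. cmod (ct K k) * real k ^ j)" for K j
    by (intro summable_comparison_test'[OF sm[of j], of 0]) auto
  have head_smooth: "head K \<in> smooth_circle" for K
    using complex_smooth_sum[of "{..<K}" "\<lambda>k t. c k * cis (- (of_int (int k) * t))", OF complex_smooth_scale[OF complex_smooth_cis_neg]]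
    unfolding head_def complex_smooth_def by blast
  have tail_smooth: "tail K \<in> smooth_circle" for K
    unfolding tail_def by (rule rapid_series_smooth(1)[OF smt])
  have split: "f = (\<lambda>t. head K t + tail K t)" for K
  proof
    fix t
    define g where "g k = Re (c k * cis (- (real k * t)))" for k
    have "summable g"
      using rapid_series_derivative(2)[OF sm, of 0 t] unfolding g_def [abs_def] by (simp only: power_0 mult_1_right)
    then have "(\<lambda>k. g k - (if k \<in> {..<K} then g k else 0)) sums (f t - (\<Sum>k<K. g k))"
      unfolding f_def g_def [symmetric] by (intro sums_diff summable_sums sums_If_finite_set) auto
    also have "(\<lambda>k. g k - (if k \<in> {..<K} then g k else 0)) = (\<lambda>k. Re (ct K k * cis (- (real k * t))))"
      by (auto simp: g_def ct_def)
    finally have "tail K t = f t - (\<Sum>k<K. g k)" by (simp add: tail_def sums_iff)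
    then show "f t = head K t + tail K t" by (simp add: head_def g_def)
  qed
  have head_val: "T (head K) = (\<Sum>k<K. Re (c k * fourier T (int k)))" for K
  proof -
    have "T (head K) = Re (complexify T (\<lambda>t. \<Sum>k<K. c k * cis (- (of_int (int k) * t))))"
      by (simp add: complexify_def head_def)
    then show ?thesis by (simp add: complexify_trig_poly[OF lin] del: of_int_of_nat_eq)
  qed
  have tail_bound: "\<bar>T (tail K)\<bar> \<le> \<bar>C\<bar> * (\<Sum>j\<le>N. M j K)" for K
  proof -
    have bd: "\<bar>(deriv ^^ j) (tail K) x\<bar> \<le> M j K" for j x
      unfolding tail_def M_def by (rule rapid_series_smooth(2)[OF smt])
    then have "bdd_above (range (\<lambda>x. \<bar>(deriv ^^ j) (tail K) x\<bar>))" for j by (meson bdd_aboveI2)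
    then have "0 \<le> (SUP x. \<bar>(deriv ^^ j) (tail K) x\<bar>)" for j
      using cSUP_upper[of 0 UNIV "\<lambda>x. \<bar>(deriv ^^ j) (tail K) x\<bar>"] by (meson UNIV_I abs_ge_zero order_trans)
    moreover have "(SUP x. \<bar>(deriv ^^ j) (tail K) x\<bar>) \<le> M j K" for j
      using bd by (intro cSUP_least) auto
    \<comment> \<open>The constant of the continuity estimate may be negative, hence its absolute
      value.\<close>
    ultimately have "C * (\<Sum>j\<le>N. SUP x. \<bar>(deriv ^^ j) (tail K) x\<bar>) \<le> \<bar>C\<bar> * (\<Sum>j\<le>N. M j K)"
      by (intro mult_mono sum_mono sum_nonneg) auto
    then show ?thesis using CN[OF tail_smooth, of K] by linarith
  qed
  have M0: "M j \<longlonglongrightarrow> 0" for j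
  proof -
    define a where "a k = cmod (c k) * real k ^ j" for k
    have "M j K = suminf a - (\<Sum>k<K. a k)" for K
    proof -
      have "(\<lambda>k. a k - (if k \<in> {..<K} then a k else 0)) sums (suminf a - (\<Sum>k<K. a k))"
        using sm[of j] unfolding a_def [symmetric] by (intro sums_diff summable_sums sums_If_finite_set) auto
      also have "(\<lambda>k. a k - (if k \<in> {..<K} then a k else 0)) = (\<lambda>k. cmod (ct K k) * real k ^ j)"
        by (auto simp: a_def ct_def)
      finally show ?thesis by (simp add: M_def sums_iff)
    qed
    moreover have "(\<lambda>K. suminf a - (\<Sum>k<K. a k)) \<longlonglongrightarrow> suminf a - suminf a"
      by (intro tendsto_diff tendsto_const summable_LIMSEQ) (use sm[of j] in \<open>simp add: a_def\<close>)
    ultimately have "(\<lambda>K. M j K) \<longlonglongrightarrow> suminf a - suminf a" by (simp only:)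
    then show ?thesis by simp
  qed
  have "(\<lambda>K. \<bar>C\<bar> * (\<Sum>j\<le>N. M j K)) \<longlonglongrightarrow> \<bar>C\<bar> * (\<Sum>j\<le>N. 0)"
    by (intro tendsto_mult tendsto_const tendsto_sum M0)
  then have "(\<lambda>K. \<bar>C\<bar> * (\<Sum>j\<le>N. M j K)) \<longlonglongrightarrow> 0" by simp
  then have "(\<lambda>K. T (tail K)) \<longlonglongrightarrow> 0"
    by (rule Lim_null_comparison[rotated]) (use tail_bound in simp)
  then have "(\<lambda>K. T f - T (tail K)) \<longlonglongrightarrow> T f - 0" by (intro tendsto_diff tendsto_const)
  moreover have "T f - T (tail K) = (\<Sum>k<K. Re (c k * fourier T (int k)))" for K
    by (subst split[of K], subst functional_add[OF lin head_smooth tail_smooth]) (simp add: head_val)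
  ultimately show ?thesis by (simp add: sums_def f_def)
qed

lemma distribution_rapid_series:
  fixes c :: "nat \<Rightarrow> complex"
  assumes T: "circle_distribution T" and sm: "\<And>j. summable (\<lambda>k. cmod (c k) * real k ^ j)"
  shows "summable (\<lambda>k. c k * fourier T (int k))"
    and "T (\<lambda>t. \<Sum>k. Re (c k * cis (- (real k * t)))) = Re (\<Sum>k. c k * fourier T (int k))"
proof -
  \<comment> \<open>Replacing c by -i c turns the statement on real parts into one on imaginary
    parts.\<close>
  have "summable (\<lambda>k. cmod (- \<i> * c k) * real k ^ j)" for j using sm[of j] by (simp add: norm_mult)
  from distribution_rapid_series_Re[OF T this]
  have "summable (\<lambda>k. Re (- \<i> * c k * fourier T (int k)))" by (rule sums_summable)
  moreover have "Re (- \<i> * c k * fourier T (int k)) = Im (c k * fourier T (int k))" for k by simp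
  ultimately have "summable (\<lambda>k. Im (c k * fourier T (int k)))" by (simp only:)
  moreover note Re = distribution_rapid_series_Re[OF T sm]
  ultimately show s: "summable (\<lambda>k. c k * fourier T (int k))"
    by (simp only: summable_complex_iff sums_summable)
  show "T (\<lambda>t. \<Sum>k. Re (c k * cis (- (real k * t)))) = Re (\<Sum>k. c k * fourier T (int k))"
    using sums_unique2[OF Re] sums_Re[OF summable_sums[OF s]] by blast
qed

text \<open>The operator x d/dx multiplies the k-th coefficient by k and preserves the disk of
  convergence.\<close>

lemma summable_power_times_poly:
  fixes x :: real
  assumes "\<bar>x\<bar> < 1"
  shows "summable (\<lambda>k. real k ^ j * x ^ k)"
  using assms
proof (induction j arbitrary: x)
  case 0
  then show ?case by (simp add: summable_geometric)
next
  case (Suc j)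
  have "summable (\<lambda>n. diffs (\<lambda>k. real k ^ j) n * x ^ n)"
    by (rule termdiff_converges[of _ 1]) (use Suc in auto)
  from summable_mult[OF this, of x] have "summable (\<lambda>n. real (Suc n) ^ Suc j * x ^ Suc n)"
    by (simp add: diffs_def mult_ac)
  then show ?case by (subst (asm) summable_Suc_iff)
qed

text \<open>With zeta = z e^{-it}, the kernel is Re(1/(1 - zeta))/pi - 1/(2 pi). The subtracted
  constant halves the weight of the term k = 0.\<close>

lemma poisson_kernel_series:
  fixes z :: complex
  assumes "cmod z < 1"
  defines "c \<equiv> \<lambda>k. if k = 0 then complex_of_real (1 / (2 * pi)) else z ^ k / complex_of_real pi"
  shows "poisson_kernel (cmod z) (Arg z - t) = (\<Sum>k. Re (c k * cis (- (real k * t))))"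
proof -
  define \<zeta> where "\<zeta> = z * cis (- t)"
  have nz: "cmod \<zeta> < 1" using assms by (simp add: \<zeta>_def norm_mult)
  then have "\<zeta> \<noteq> 1" by auto
  have "(\<lambda>k. complex_of_real (1 / pi) * \<zeta> ^ k - (if k = 0 then complex_of_real (1 / (2 * pi)) else 0)) sums
      (complex_of_real (1 / pi) * (1 / (1 - \<zeta>)) - complex_of_real (1 / (2 * pi)))"
    by (intro sums_diff sums_mult geometric_sums nz sums_single)
  moreover have "complex_of_real (1 / pi) * \<zeta> ^ k - (if k = 0 then complex_of_real (1 / (2 * pi)) else 0) = c k * cis (- (real k * t))" for k
    by (auto simp: c_def \<zeta>_def power_mult_distrib Complex.DeMoivre field_simps)
  ultimately have "(\<lambda>k. c k * cis (- (real k * t))) sums (complex_of_real (1 / pi) * (1 / (1 - \<zeta>)) - complex_of_real (1 / (2 * pi)))"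
    by (simp only:)
  then have "(\<lambda>k. Re (c k * cis (- (real k * t)))) sums Re (complex_of_real (1 / pi) * (1 / (1 - \<zeta>)) - complex_of_real (1 / (2 * pi)))"
    by (rule sums_Re)
  then have S: "(\<Sum>k. Re (c k * cis (- (real k * t)))) = Re (complex_of_real (1 / pi) * (1 / (1 - \<zeta>)) - complex_of_real (1 / (2 * pi)))"
    by (simp add: sums_iff)
  have rc: "\<zeta> = rcis (cmod z) (Arg z - t)"
    using rcis_cmod_Arg[of z] by (simp add: \<zeta>_def rcis_def flip: cis_mult)
       (metis cis_mult diff_conv_add_uminus mult.assoc rcis_def)
  have D: "(cmod (1 - \<zeta>))\<^sup>2 = 1 - 2 * cmod z * cos (Arg z - t) + (cmod z)\<^sup>2"
  proof -
    have "(cmod z * cos (Arg z - t))\<^sup>2 + (cmod z * sin (Arg z - t))\<^sup>2 = (cmod z)\<^sup>2"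
      by (simp add: power_mult_distrib flip: distrib_left)
    then show ?thesis unfolding rc by (simp add: cmod_power2 power2_diff)
  qed
  have R: "Re (1 / (1 - \<zeta>)) = (1 - cmod z * cos (Arg z - t)) / (cmod (1 - \<zeta>))\<^sup>2"
    by (simp add: rc Re_divide cmod_power2)
  have nz: "(cmod (1 - \<zeta>))\<^sup>2 \<noteq> 0" using \<open>\<zeta> \<noteq> 1\<close> by simp
  have "Re (complex_of_real a * w - complex_of_real b) = a * Re w - b" for a b w by simp
  then have S': "(\<Sum>k. Re (c k * cis (- (real k * t)))) = 1 / pi * Re (1 / (1 - \<zeta>)) - 1 / (2 * pi)"
    using S by (simp only:)
  have alg: "1 / (2 * pi) * ((1 - s) / (1 - 2 * q + s)) = 1 / pi * ((1 - q) / (1 - 2 * q + s)) - 1 / (2 * pi)"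
    if "1 - 2 * q + s \<noteq> 0" for q s :: real
  proof -
    define D where "D = 1 - 2 * q + s"
    have "1 / (2 * pi) * ((2 * (1 - q) - D) / D) = 1 / pi * ((1 - q) / D) - 1 / (2 * pi)"
      using that unfolding D_def [symmetric] by (simp add: field_simps)
    moreover have "2 * (1 - q) - D = 1 - s" by (simp add: D_def)
    ultimately show ?thesis by (simp only: D_def)
  qed
  show ?thesis
    unfolding S' R D poisson_kernel_def mult.assoc
    by (rule alg) (use nz D in \<open>simp add: mult.assoc\<close>)
qed

lemma poisson_extension_series:
  assumes T: "circle_distribution T" and z: "cmod z < 1"
  defines "b \<equiv> \<lambda>k::nat. (if k = 0 then complex_of_real (1 / (2 * pi)) else complex_of_real (1 / pi)) * fourier T (int k)"
  shows "summable (\<lambda>k. b k * z ^ k)" and "poisson_extension T z = Re (\<Sum>k. b k * z ^ k)"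
proof -
  define c where "c = (\<lambda>k::nat. if k = 0 then complex_of_real (1 / (2 * pi)) else z ^ k / complex_of_real pi)"
  have eq: "c k * fourier T (int k) = b k * z ^ k" for k by (auto simp: c_def b_def)
  have sm: "summable (\<lambda>k. cmod (c k) * real k ^ j)" for j
  proof (rule summable_comparison_test'[of _ 0])
    show "summable (\<lambda>k. real k ^ j * cmod z ^ k)"
      using z by (intro summable_power_times_poly) simp
    fix k
    have "1 / pi \<le> 1" "1 / (2 * pi) \<le> 1" using pi_gt3 by (simp_all add: field_simps)
    then have "cmod (c k) \<le> cmod z ^ k"
      using mult_left_mono[of "1 / pi" 1 "cmod z ^ k"]
      by (auto simp: c_def norm_mult norm_divide norm_power)
    from mult_right_mono[OF this, of "real k ^ j"]
    show "norm (cmod (c k) * real k ^ j) \<le> real k ^ j * cmod z ^ k"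
      by (simp add: mult.commute)
  qed
  show "summable (\<lambda>k. b k * z ^ k)"
    using distribution_rapid_series(1)[OF T sm] by (simp only: eq)
  have "poisson_extension T z = T (\<lambda>t. \<Sum>k. Re (c k * cis (- (real k * t))))"
    unfolding poisson_extension_def c_def poisson_kernel_series[OF z] ..
  also have "\<dots> = Re (\<Sum>k. b k * z ^ k)"
    using distribution_rapid_series(2)[OF T sm] by (simp only: eq)
  finally show "poisson_extension T z = Re (\<Sum>k. b k * z ^ k)" .
qed

text \<open>A nonconstant holomorphic function has an open image, which cannot lie in the imaginary
  axis.\<close>

lemma holomorphic_Re_zero_imp_constant:
  assumes "f holomorphic_on ball 0 1" "\<And>z. z \<in> ball 0 1 \<Longrightarrow> Re (f z) = 0" "z \<in> ball 0 1"
  shows "f z = f 0"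
proof (rule ccontr)
  assume "f z \<noteq> f 0"
  then have "\<not> f constant_on ball 0 1"
    using assms(3) unfolding constant_on_def by (metis centre_in_ball zero_less_one)
  then have "open (f ` ball 0 1)"
    by (intro open_mapping_thm[OF assms(1)]) auto
  moreover have "f 0 \<in> f ` ball 0 1" by simp
  ultimately obtain e where e: "e > 0" "ball (f 0) e \<subseteq> f ` ball 0 1" by (meson openE)
  then have "f 0 + of_real (e / 2) \<in> f ` ball 0 1"
    by (intro subsetD[OF e(2)]) (simp add: dist_norm)
  then obtain x where x: "x \<in> ball 0 1" "f 0 + of_real (e / 2) = f x" by blast
  have "Re (f 0 + of_real (e / 2)) = 0" unfolding x(2) by (rule assms(2)[OF x(1)])
  moreover have "Re (f 0) = 0" using assms(2) by simp
  ultimately show False using e(1) by simp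
qed

text \<open>\<open>w\<close> differs from the Poisson power series by a function with vanishing real
  part, hence by a constant. Now w(0) = 0 forces coefficient 0 of T to vanish, so the halved
  constant term disappears and every coefficient of w is t_k/pi.\<close>

lemma conjugate_potential_series:
  assumes T: "circle_distribution T" and u: "u = poisson_extension T"
    and w: "w holomorphic_on ball 0 1" "\<forall>z\<in>ball 0 1. Re (w z) = u z" "w 0 = 0"
  shows "fourier T 0 = 0"
    and "z \<in> ball 0 1 \<Longrightarrow> (\<lambda>k. fourier T (int k) / of_real pi * z ^ k) sums w z"
proof -
  define b where "b = (\<lambda>k::nat. (if k = 0 then complex_of_real (1 / (2 * pi)) else complex_of_real (1 / pi)) * fourier T (int k))"
  define W where "W z = (\<Sum>k. b k * z ^ k)" for z
  have ser: "summable (\<lambda>k. b k * z ^ k)" "poisson_extension T z = Re (\<Sum>k. b k * z ^ k)"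
    if "cmod z < 1" for z
    unfolding b_def by (rule poisson_extension_series[OF T that])+
  have sW: "(\<lambda>k. b k * z ^ k) sums W z" if "z \<in> ball 0 1" for z
    using ser(1)[of z] that unfolding W_def by (intro summable_sums) (simp add: dist_norm)
  have holW: "W holomorphic_on ball 0 1"
    by (rule power_series_holomorphic[where a = b]) (use sW in simp)
  have const: "w z - W z = w 0 - W 0" if "z \<in> ball 0 1" for z
  proof (rule holomorphic_Re_zero_imp_constant[of "\<lambda>z. w z - W z", OF _ _ that])
    show "(\<lambda>z. w z - W z) holomorphic_on ball 0 1" by (intro holomorphic_on_diff w holW)
    show "Re (w y - W y) = 0" if "y \<in> ball 0 1" for y
      using w(2) that ser(2)[of y] by (simp add: u W_def dist_norm)
  qed
  have W0: "W 0 = b 0" unfolding W_def by (simp add: suminf_finite[of "{0}"])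
  have im: "Im (fourier T 0) = 0"
    using functional_zero[OF circle_distribution_linear[OF T]]
    by (simp add: fourier_def complexify_def)
  have "Re (W 0) = 0" using w(2)[rule_format, of 0] w(3) ser(2)[of 0] by (simp add: W_def u)
  then have "Re (fourier T 0) = 0" by (simp add: W0 b_def)
  with im show f0: "fourier T 0 = 0" by (simp add: complex_eq_iff)
  show "(\<lambda>k. fourier T (int k) / of_real pi * z ^ k) sums w z" if "z \<in> ball 0 1"
  proof -
    have "w z = W z" using const[OF that] w(3) f0 by (simp add: W0 b_def)
    moreover have "b k = fourier T (int k) / of_real pi" for k using f0 by (auto simp: b_def)
    ultimately show ?thesis using sW[OF that] by simp
  qed
qed

subsection \<open>Trigonometric polynomials with prescribed zeros\<close>

text \<open>Pulling out e^{-it/2} leaves a factor linear in e^{it}, so that a product of sines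
  becomes a polynomial in e^{it}.\<close>

lemma sin_half_factor:
  "complex_of_real (sin ((t - a) / 2)) = \<i> / 2 * cis (a / 2) * cis (- (t / 2)) * (1 - cis (- a) * cis t)"
proof -
  have "cis (a / 2) * cis (- (t / 2)) * (1 - cis (- a) * cis t) = cis ((a - t) / 2) - cis ((t - a) / 2)"
    by (simp add: cis_mult right_diff_distrib diff_divide_distrib)
  moreover have "(a - t) / 2 = - ((t - a) / 2)" by (simp add: field_simps)
  moreover have "complex_of_real (sin x) = \<i> / 2 * (cis (- x) - cis x)" for x
    by (simp add: complex_eq_iff)
  ultimately show ?thesis by (simp only: mult.assoc)
qed

context
  fixes n :: nat and \<theta> :: "nat \<Rightarrow> real" and \<sigma> :: real
begin

text \<open>Normalised to constant coefficient 1, so that multiplying a power series by it keeps the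
  leading coefficient.\<close>

definition zero_poly :: "complex poly" where
  "zero_poly = (\<Prod>j<2 * n. [:1, - cis (- \<theta> j):])"

text \<open>The kappa of the overview, collected from the constants in
  \<open>sin_half_factor\<close>.\<close>

definition trig_const :: complex where
  "trig_const = of_real \<sigma> * (\<Prod>j<2 * n. \<i> / 2 * cis (\<theta> j / 2))"

definition trig_poly :: "real \<Rightarrow> real" where
  "trig_poly t = \<sigma> * (\<Prod>j<2 * n. sin ((t - \<theta> j) / 2))"

definition weighted :: "((real \<Rightarrow> real) \<Rightarrow> real) \<Rightarrow> (real \<Rightarrow> real) \<Rightarrow> real" where
  "weighted T f = T (\<lambda>t. trig_poly t * f t)"

lemma trig_poly_eq: "complex_of_real (trig_poly t) = trig_const * cis (- (real n * t)) * poly zero_poly (cis t)"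
proof -
  have "complex_of_real (trig_poly t) = of_real \<sigma> * (\<Prod>j<2 * n. \<i> / 2 * cis (\<theta> j / 2) * cis (- (t / 2)) * (1 - cis (- \<theta> j) * cis t))"
    by (simp only: trig_poly_def of_real_mult of_real_prod sin_half_factor)
  also have "\<dots> = trig_const * cis (- (t / 2)) ^ (2 * n) * poly zero_poly (cis t)"
    by (simp only: trig_const_def zero_poly_def poly_prod prod.distrib prod_constant card_lessThan)
       (simp add: mult_ac)
  also have "cis (- (t / 2)) ^ (2 * n) = cis (- (real n * t))"
    by (subst Complex.DeMoivre) (simp add: field_simps)
  finally show ?thesis .
qed

lemma degree_zero_poly: "degree zero_poly = 2 * n"
  unfolding zero_poly_def by (subst degree_prod_eq_sum_degree) auto

lemma coeff_zero_poly_0: "coeff zero_poly 0 = 1"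
  by (simp add: zero_poly_def flip: poly_0_coeff_0) (simp add: poly_prod)

lemma coeff_zero_poly_1: "coeff zero_poly 1 = - (\<Sum>j<2 * n. cis (- \<theta> j))"
proof -
  have "coeff (\<Prod>j\<in>A. [:1, - c j:]) 0 = 1 \<and> coeff (\<Prod>j\<in>A. [:1, - c j:]) 1 = - (\<Sum>j\<in>A. c j)"
    if "finite A" for A and c :: "nat \<Rightarrow> complex"
    using that by (induction A) (auto simp: coeff_pCons split: nat.splits)
  from this[of "{..<2 * n}" "\<lambda>j. cis (- \<theta> j)"] show ?thesis by (simp add: zero_poly_def)
qed

lemma coeff_zero_poly_top: "coeff zero_poly (2 * n) = (\<Prod>j<2 * n. cis (- \<theta> j))"
proof -
  have "lead_coeff zero_poly = (\<Prod>j<2 * n. - cis (- \<theta> j))"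
    unfolding zero_poly_def by (subst lead_coeff_prod) simp
  also have "\<dots> = (\<Prod>j<2 * n. - 1) * (\<Prod>j<2 * n. cis (- \<theta> j))"
    by (subst prod.distrib [symmetric]) simp
  also have "(\<Prod>j<2 * n. - 1 :: complex) = 1" by simp
  finally show ?thesis by (simp add: degree_zero_poly)
qed

text \<open>This expresses that p is real: the left side is its coefficient of e^{int}, the
  conjugate of the one of e^{-int}.\<close>

lemma trig_const_mult: "trig_const * (\<Prod>j<2 * n. cis (- \<theta> j)) = cnj trig_const"
proof -
  have "trig_const * (\<Prod>j<2 * n. cis (- \<theta> j)) = of_real \<sigma> * (\<Prod>j<2 * n. \<i> / 2 * cis (\<theta> j / 2) * cis (- \<theta> j))"
    by (simp only: trig_const_def prod.distrib mult.assoc)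
  also have "(\<Prod>j<2 * n. \<i> / 2 * cis (\<theta> j / 2) * cis (- \<theta> j)) = (\<Prod>j<2 * n. - 1 * (- \<i> / 2 * cis (- (\<theta> j / 2))))"
    by (intro prod.cong) (auto simp: cis_mult mult.assoc)
  also have "\<dots> = (\<Prod>j<2 * n. - \<i> / 2 * cis (- (\<theta> j / 2)))"
    by (subst prod.distrib) simp
  finally show ?thesis by (simp add: trig_const_def cis_cnj)
qed

lemma trig_const_nonzero: "\<bar>\<sigma>\<bar> = 1 \<Longrightarrow> trig_const \<noteq> 0"
  by (auto simp: trig_const_def)

context
  fixes T :: "(real \<Rightarrow> real) \<Rightarrow> real"
  assumes n: "n \<ge> 1" and \<sigma>: "\<bar>\<sigma>\<bar> = 1" and T: "linear_functional T"
    and van: "\<And>k. \<bar>k\<bar> < int n \<Longrightarrow> fourier T k = 0"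
begin

lemma fourier_weighted:
  "fourier (weighted T) k = trig_const * (\<Sum>m\<le>2 * n. coeff zero_poly m * fourier T (k + int n - int m))"
proof -
  have "of_real (trig_poly t) * cis (- (of_int k * t)) =
      (\<Sum>m\<le>2 * n. trig_const * coeff zero_poly m * cis (- (of_int (k + int n - int m) * t)))" for t
  proof -
    have "cis (- (real n * t)) * cis t ^ m * cis (- (of_int k * t)) = cis (- (of_int (k + int n - int m) * t))" for m
      by (simp add: Complex.DeMoivre cis_mult algebra_simps)
    note exponents = this
    have "of_real (trig_poly t) * cis (- (of_int k * t)) =
        (\<Sum>m\<le>2 * n. trig_const * cis (- (real n * t)) * (coeff zero_poly m * cis t ^ m) * cis (- (of_int k * t)))"
      by (simp only: trig_poly_eq poly_altdef degree_zero_poly sum_distrib_left sum_distrib_right)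
    also have "\<dots> = (\<Sum>m\<le>2 * n. trig_const * coeff zero_poly m * (cis (- (real n * t)) * cis t ^ m * cis (- (of_int k * t))))"
      by (simp only: mult_ac)
    finally show ?thesis by (simp only: exponents)
  qed
  then have "complexify T (\<lambda>t. of_real (trig_poly t) * cis (- (of_int k * t))) =
      (\<Sum>m\<le>2 * n. trig_const * coeff zero_poly m * fourier T (k + int n - int m))"
    using complexify_trig_poly[OF T, where A = "{..2 * n}" and c = "\<lambda>m. trig_const * coeff zero_poly m" and \<kappa> = "\<lambda>m. k + int n - int m"]
    by presburger
  then show ?thesis
    by (simp add: fourier_def complexify_def weighted_def sum_distrib_left mult.assoc)
qed

text \<open>Among the indices n - m only n and -n avoid the range where T has coefficient 0; since p
  and T are real, the two terms are conjugate.\<close>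

lemma fourier_weighted_0: "fourier (weighted T) 0 = 2 * of_real (Re (trig_const * fourier T (int n)))"
proof -
  have "{..2 * n} = insert 0 (insert (2 * n) {0<..<2 * n})" using n by auto
  moreover have "(\<Sum>m\<in>{0<..<2 * n}. coeff zero_poly m * fourier T (0 + int n - int m)) = 0"
    by (intro sum.neutral ballI) (auto simp: van)
  ultimately have "fourier (weighted T) 0 = trig_const * (fourier T (int n) + coeff zero_poly (2 * n) * fourier T (- int n))"
    using n by (simp add: fourier_weighted coeff_zero_poly_0)
  also have "\<dots> = trig_const * fourier T (int n) + trig_const * coeff zero_poly (2 * n) * fourier T (- int n)"
    by (simp only: distrib_left mult.assoc)
  also have "\<dots> = trig_const * fourier T (int n) + cnj (trig_const * fourier T (int n))"
    by (simp only: coeff_zero_poly_top trig_const_mult fourier_minus[OF T] complex_cnj_mult)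
  finally show ?thesis by (simp only: complex_add_cnj of_real_mult of_real_numeral)
qed

text \<open>For 2 <= m <= 2n the index 1 + n - m lies strictly between -n and n, so only the two
  lowest coefficients of \<open>zero_poly\<close> contribute.\<close>

lemma fourier_weighted_1:
  "fourier (weighted T) 1 = trig_const * (fourier T (int n + 1) - fourier T (int n) * (\<Sum>j<2 * n. cis (- \<theta> j)))"
proof -
  have "{..2 * n} = insert 0 (insert 1 {1<..2 * n})" using n by auto
  moreover have "(\<Sum>m\<in>{1<..2 * n}. coeff zero_poly m * fourier T (1 + int n - int m)) = 0"
    by (intro sum.neutral ballI) (auto intro!: van)
  ultimately show ?thesis
    using coeff_zero_poly_1 by (simp add: fourier_weighted coeff_zero_poly_0 algebra_simps)
qed

text \<open>A power series has no negative indices. For k >= 1 no index k + n - m falls below 1 - n,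
  so the coefficient of z^(n+k) is the full convolution nu_k/kappa; for k = 0 the term with t_{-n}
  is missing and t_n alone remains.\<close>

lemma zero_poly_times_series:
  assumes w: "(\<lambda>k. fourier T (int k) * z ^ k) sums w"
  shows "(\<lambda>k. z ^ (n + k) * (if k = 0 then fourier T (int n) else fourier (weighted T) (int k) / trig_const)) sums (poly zero_poly z * w)"
proof -
  \<comment> \<open>Extending the coefficients by zero to all integers below n makes multiplication
    by z^m a plain index shift.\<close>
  define s where "s k = (if k < int n then 0 else fourier T k)" for k :: int
  have w': "(\<lambda>k. s (int k) * z ^ k) sums w"
  proof -
    have "fourier T (int k) * z ^ k = s (int k) * z ^ k" for k by (auto simp: s_def van)
    then show ?thesis using w by (simp only:)
  qed
  have shift: "(\<lambda>k. s (int k - int m) * z ^ k) sums (z ^ m * w)" for m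
  proof -
    have "(\<lambda>k. s (int (k + m) - int m) * z ^ (k + m)) sums (z ^ m * w)"
      using sums_mult[OF w', of "z ^ m"] by (simp add: power_add mult_ac)
    moreover have "(\<Sum>k<m. s (int k - int m) * z ^ k) = 0"
      by (intro sum.neutral ballI) (auto simp: s_def)
    ultimately show ?thesis
      using sums_iff_shift[of "\<lambda>k. s (int k - int m) * z ^ k" m "z ^ m * w"] by simp
  qed
  have "(\<lambda>k. \<Sum>m\<le>2 * n. coeff zero_poly m * (s (int k - int m) * z ^ k)) sums (\<Sum>m\<le>2 * n. coeff zero_poly m * (z ^ m * w))"
    by (intro sums_sum sums_mult shift)
  also have "(\<Sum>m\<le>2 * n. coeff zero_poly m * (z ^ m * w)) = poly zero_poly z * w"
    by (simp only: poly_altdef degree_zero_poly sum_distrib_right mult.assoc)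
  finally have S: "(\<lambda>k. z ^ k * (\<Sum>m\<le>2 * n. coeff zero_poly m * s (int k - int m))) sums (poly zero_poly z * w)"
    by (simp add: sum_distrib_left mult_ac)
  have low: "(\<Sum>m\<le>2 * n. coeff zero_poly m * s (int k - int m)) = 0" if "k < n" for k
    using that by (intro sum.neutral ballI) (simp add: s_def)
  have mid: "(\<Sum>m\<le>2 * n. coeff zero_poly m * s (int (k + n) - int m)) =
      (if k = 0 then fourier T (int n) else fourier (weighted T) (int k) / trig_const)" for k
  proof (cases "k = 0")
    case True
    have "{..2 * n} = insert 0 {0<..2 * n}" by auto
    moreover have "(\<Sum>m\<in>{0<..2 * n}. coeff zero_poly m * s (int n - int m)) = 0"
      by (intro sum.neutral ballI) (simp add: s_def)
    ultimately show ?thesis using True by (simp add: coeff_zero_poly_0 s_def)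
  next
    case False
    have "s (int (k + n) - int m) = fourier T (int k + int n - int m)" if "m \<le> 2 * n" for m
      using that False by (auto simp: s_def van)
    then show ?thesis using False trig_const_nonzero[OF \<sigma>] by (simp add: fourier_weighted)
  qed
  have "(\<lambda>k. z ^ (k + n) * (\<Sum>m\<le>2 * n. coeff zero_poly m * s (int (k + n) - int m))) sums (poly zero_poly z * w)"
    using S sums_iff_shift[of "\<lambda>k. z ^ k * (\<Sum>m\<le>2 * n. coeff zero_poly m * s (int k - int m))" n "poly zero_poly z * w"]
    by (simp add: low)
  then show ?thesis by (simp only: mid add.commute[of n])
qed

end

end

subsection \<open>Order of vanishing and curvature at the origin\<close>

text \<open>Used for \<open>w\<close> and for nodal curves: value and derivative of \<open>h\<close>
  at 0 are the two leading coefficients, on which the curvature condition depends.\<close>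

lemma power_series_shift:
  fixes f :: "complex \<Rightarrow> complex"
  assumes f: "\<And>z. z \<in> ball 0 r \<Longrightarrow> (\<lambda>k. a k * z ^ k) sums f z" and "r > 0" and low: "\<And>k. k < n \<Longrightarrow> a k = 0"
  obtains h where "h holomorphic_on ball 0 r" "\<And>z. z \<in> ball 0 r \<Longrightarrow> f z = z ^ n * h z"
    "h 0 = a n" "(h has_field_derivative a (n + 1)) (at 0)"
proof -
  define h where "h z = (if z = 0 then a n else f z / z ^ n)" for z
  have h: "(\<lambda>k. a (k + n) * z ^ k) sums h z" if "z \<in> ball 0 r" for z
  proof (cases "z = 0")
    case True
    then show ?thesis by (simp add: h_def)
  next
    case False
    have "(\<lambda>k. a (k + n) * z ^ (k + n)) sums f z"
      using f[OF that] sums_iff_shift[of "\<lambda>k. a k * z ^ k" n "f z"] by (simp add: low)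
    from sums_divide[OF this, of "z ^ n"] show ?thesis
      using False by (simp add: h_def power_add)
  qed
  have hol: "h holomorphic_on ball 0 r"
    by (rule power_series_holomorphic[where a = "\<lambda>k. a (k + n)"]) (use h in simp)
  moreover have "f z = z ^ n * h z" if "z \<in> ball 0 r" for z
    using f[OF \<open>z \<in> ball 0 r\<close>] by (cases "z = 0"; cases "n = 0") (auto simp: h_def low)
  moreover have "(h has_field_derivative a (n + 1)) (at 0)"
  proof -
    have "h has_fps_expansion Abs_fps (\<lambda>k. a (k + n))"
    proof (rule has_fps_expansionI)
      show "\<forall>\<^sub>F u in nhds 0. (\<lambda>k. fps_nth (Abs_fps (\<lambda>k. a (k + n))) k * u ^ k) sums h u"
        by (rule eventually_mono[OF eventually_nhds_in_open[of "ball 0 r" 0]]) (simp_all add: h \<open>r > 0\<close>)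
    qed
    from fps_nth_fps_expansion[OF this, of 1] have "deriv h 0 = a (n + 1)" by simp
    then show ?thesis
      using holomorphic_derivI[OF hol, of 0] \<open>r > 0\<close> by simp
  qed
  ultimately show ?thesis using that[of h] by (simp add: h_def)
qed

lemma power_series_higher_deriv:
  fixes f :: "complex \<Rightarrow> complex"
  assumes "\<And>z. z \<in> ball 0 r \<Longrightarrow> (\<lambda>k. a k * z ^ k) sums f z" "r > 0"
  shows "(deriv ^^ k) f 0 = fact k * a k"
proof -
  have "f has_fps_expansion Abs_fps a"
  proof (rule has_fps_expansionI)
    show "\<forall>\<^sub>F u in nhds 0. (\<lambda>k. fps_nth (Abs_fps a) k * u ^ k) sums f u"
      by (rule eventually_mono[OF eventually_nhds_in_open[of "ball 0 r" 0]]) (simp_all add: assms)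
  qed
  from fps_nth_fps_expansion[OF this, of k] show ?thesis by (simp add: field_simps)
qed

lemma has_vector_derivative_along_line:
  assumes "(g has_field_derivative g') (at (z + d * complex_of_real s))"
  shows "((\<lambda>t. g (z + d * complex_of_real t)) has_vector_derivative d * g') (at s)"
proof -
  have "((\<lambda>t. z + d * complex_of_real t) has_vector_derivative d) (at s)"
    by (auto intro!: derivative_eq_intros)
  from field_vector_diff_chain_at[OF this assms] show ?thesis by (simp add: o_def)
qed

text \<open>\<open>v\<close> is compared with Re g only on the disk, where short segments from z
  remain; this allows iteration with iterated partial derivatives in place of
  \<open>v\<close>.\<close>

lemma partial_Re_holomorphic:
  assumes g: "g holomorphic_on ball 0 1" and v: "\<And>z. z \<in> ball 0 1 \<Longrightarrow> v z = Re (g z)" and z: "z \<in> ball 0 1"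
  shows "partial_x v z = Re (deriv g z)" "partial_y v z = Re (\<i> * deriv g z)"
proof -
  have dir: "deriv (\<lambda>t. v (z + d * complex_of_real t)) 0 = Re (d * deriv g z)" if "cmod d = 1" for d
  proof -
    have "(g has_field_derivative deriv g z) (at z)" using holomorphic_derivI[OF g open_ball z] .
    then have "(g has_field_derivative deriv g z) (at (z + d * complex_of_real 0))" by simp
    from has_vector_derivative_along_line[OF this] have "((\<lambda>t. Re (g (z + d * complex_of_real t))) has_real_derivative Re (d * deriv g z)) (at 0)"
      unfolding has_real_derivative_iff_has_vector_derivative
      by (rule bounded_linear.has_vector_derivative[OF bounded_linear_Re])
    moreover have "eventually (\<lambda>t. z + d * complex_of_real t \<in> ball 0 1) (nhds 0)"
    proof -
      have "((\<lambda>t. z + d * complex_of_real t) \<longlongrightarrow> z + d * complex_of_real 0) (nhds 0)"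
        by (intro tendsto_intros filterlim_ident)
      then show ?thesis using z by (intro topological_tendstoD) auto
    qed
    then have "eventually (\<lambda>t. v (z + d * complex_of_real t) = Re (g (z + d * complex_of_real t))) (nhds 0)"
      by eventually_elim (use v in simp)
    ultimately show ?thesis using deriv_cong_ev[OF _ refl] DERIV_imp_deriv by metis
  qed
  show "partial_x v z = Re (deriv g z)" using dir[of 1] by (simp add: partial_x_def)
  show "partial_y v z = Re (\<i> * deriv g z)" using dir[of \<i>] by (simp add: partial_y_def)
qed

lemma mixed_partial_Re_holomorphic:
  assumes w: "w holomorphic_on ball 0 1" and u: "\<And>z. z \<in> ball 0 1 \<Longrightarrow> u z = Re (w z)" and z: "z \<in> ball 0 1"
  shows "(partial_x ^^ a) ((partial_y ^^ b) u) z = Re (\<i> ^ b * (deriv ^^ (a + b)) w z)"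
  using z
proof (induction a arbitrary: z)
  case 0
  then show ?case
  proof (induction b arbitrary: z)
    case (Suc b)
    have hol: "(\<lambda>z. \<i> ^ b * (deriv ^^ b) w z) holomorphic_on ball 0 1"
      by (intro holomorphic_intros holomorphic_higher_deriv w) auto
    have "deriv (\<lambda>z. \<i> ^ b * (deriv ^^ b) w z) z = \<i> ^ b * deriv ((deriv ^^ b) w) z"
      using Suc.prems holomorphic_higher_deriv[OF w, of b]
      by (intro deriv_cmult) (auto simp: holomorphic_on_open field_differentiable_def)
    then show ?case
      using partial_Re_holomorphic(2)[OF hol _ Suc.prems, of "(partial_y ^^ b) u"] Suc.IH
      by (simp add: mult.assoc)
  qed (use u in simp)
next
  case (Suc a)
  have hol: "(\<lambda>z. \<i> ^ b * (deriv ^^ (a + b)) w z) holomorphic_on ball 0 1"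
    by (intro holomorphic_intros holomorphic_higher_deriv w) auto
  have "deriv (\<lambda>z. \<i> ^ b * (deriv ^^ (a + b)) w z) z = \<i> ^ b * deriv ((deriv ^^ (a + b)) w) z"
    using Suc.prems holomorphic_higher_deriv[OF w, of "a + b"]
    by (intro deriv_cmult) (auto simp: holomorphic_on_open field_differentiable_def)
  then show ?case
    using partial_Re_holomorphic(1)[OF hol _ Suc.prems, of "(partial_x ^^ a) ((partial_y ^^ b) u)"] Suc.IH
    by simp
qed

lemma vanishes_to_order_higher_deriv:
  assumes w: "w holomorphic_on ball 0 1" "\<And>z. z \<in> ball 0 1 \<Longrightarrow> u z = Re (w z)" "w 0 = 0"
    and van: "vanishes_to_order u n 0"
  shows "m < n \<Longrightarrow> (deriv ^^ m) w 0 = 0" and "(deriv ^^ n) w 0 \<noteq> 0"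
proof -
  have part: "(partial_x ^^ a) ((partial_y ^^ b) u) 0 = Re (\<i> ^ b * (deriv ^^ (a + b)) w 0)" for a b
    by (rule mixed_partial_Re_holomorphic[OF w(1,2)]) auto
  show "(deriv ^^ m) w 0 = 0" if "m < n"
  proof (cases m)
    case 0
    then show ?thesis using w(3) by simp
  next
    case (Suc k)
    have "\<forall>a b. a + b < n \<longrightarrow> Re (\<i> ^ b * (deriv ^^ (a + b)) w 0) = 0"
      using van by (simp add: vanishes_to_order_def part)
    \<comment> \<open>The pair (m, 0) gives the real part and (m - 1, 1) the imaginary part, as one
      y-derivative brings a factor i.\<close>
    from this[rule_format, of m 0] this[rule_format, of k 1] show ?thesis
      using that Suc by (simp add: complex_eq_iff del: funpow.simps)
  qed
  show "(deriv ^^ n) w 0 \<noteq> 0"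
  proof
    assume "(deriv ^^ n) w 0 = 0"
    moreover obtain a b where "a + b = n" "(partial_x ^^ a) ((partial_y ^^ b) u) 0 \<noteq> 0"
      using van unfolding vanishes_to_order_def by blast
    ultimately show False by (simp add: part)
  qed
qed

text \<open>A real-analytic curve is locally the restriction of a holomorphic F. The claim covers a
  whole interval, so it can be applied again to the velocity.\<close>

lemma curve_deriv_power_series:
  assumes F: "F holomorphic_on ball 0 r" and \<gamma>: "\<And>s. \<bar>s - t\<bar> < r \<Longrightarrow> \<gamma> s = F (of_real (s - t))"
    and s: "\<bar>s - t\<bar> < r"
  shows "curve_deriv \<gamma> s = deriv F (of_real (s - t))"
proof -
  have "complex_of_real (s - t) \<in> ball 0 r" using s by (simp only: mem_ball dist_0_norm norm_of_real)
  then have "(F has_field_derivative deriv F (of_real (s - t))) (at (of_real (s - t)))"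
    using holomorphic_derivI[OF F open_ball] by blast
  then have "(F has_field_derivative deriv F (of_real (s - t))) (at (- of_real t + 1 * of_real s))"
    by simp
  from has_vector_derivative_along_line[OF this]
  have "((\<lambda>s. F (of_real (s - t))) has_vector_derivative deriv F (of_real (s - t))) (at s)"
    by simp
  then have "(\<gamma> has_vector_derivative deriv F (of_real (s - t))) (at s)"
    by (rule has_vector_derivative_transform_within_open[where S = "ball t r"])
       (use s \<gamma> in \<open>auto simp: dist_real_def abs_minus_commute\<close>)
  then show ?thesis unfolding curve_deriv_def by (rule vector_derivative_at)
qed

text \<open>Along the curve w is imaginary. Its leading term makes a_n v^n imaginary, with v the
  velocity; this is the condition on the tangent direction cis beta. The next term links a_{n+1} to
  the acceleration and gives Im(a_{n+1}/a_n * v/|v|) = -(n/2) times the curvature.\<close>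

lemma nodal_curvature:
  assumes w: "w holomorphic_on ball 0 1" "\<And>z. z \<in> ball 0 1 \<Longrightarrow> (\<lambda>k. a k * z ^ k) sums w z"
    and low: "\<And>k. k < n \<Longrightarrow> a k = 0" and an: "a n \<noteq> 0" and n: "n \<ge> 1"
    and u: "\<And>z. z \<in> ball 0 1 \<Longrightarrow> Re (w z) = u z"
    and arc: "nodal_arc u I \<gamma>" "t\<^sub>0 \<in> I" "\<gamma> t\<^sub>0 = 0"
  obtains \<beta> where "Re (a n * cis \<beta> ^ n) = 0"
    "\<bar>Im (a (n + 1) / a n * cis \<beta>)\<bar> = real n / 2 * \<bar>curvature \<gamma> t\<^sub>0\<bar>"
proof -
  have I: "open I" "\<And>t. t \<in> I \<Longrightarrow> curve_deriv \<gamma> t \<noteq> 0" "\<And>t. t \<in> I \<Longrightarrow> \<gamma> t \<in> ball 0 1"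
    "\<And>t. t \<in> I \<Longrightarrow> u (\<gamma> t) = 0" and an_curve: "real_analytic_curve_on \<gamma> I"
    using arc(1) by (auto simp: nodal_arc_def)
  obtain c r where r: "r > 0" and c: "\<And>s. \<bar>s - t\<^sub>0\<bar> < r \<Longrightarrow> (\<lambda>k. c k * complex_of_real (s - t\<^sub>0) ^ k) sums \<gamma> s"
    using an_curve arc(2) unfolding real_analytic_curve_on_def by blast
  define F where "F z = (\<Sum>k. c k * z ^ k)" for z
  have F: "(\<lambda>k. c k * z ^ k) sums F z" if zr: "z \<in> ball 0 r" for z
  proof -
    obtain K where K: "cmod z < K" "K < r" using zr dense[of "cmod z" r] unfolding mem_ball_0 by blast
    then have "K > 0" by (meson norm_ge_zero order_le_less_trans)
    \<comment> \<open>Convergence at a real point K with |z| < K < r carries over to the complex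
      point z.\<close>
    have "summable (\<lambda>k. c k * complex_of_real K ^ k)"
      using c[of "t\<^sub>0 + K"] K \<open>K > 0\<close> by (simp add: sums_iff)
    then have "summable (\<lambda>k. c k * z ^ k)"
      by (rule powser_inside) (use K \<open>K > 0\<close> in simp)
    then show ?thesis unfolding F_def by (rule summable_sums)
  qed
  have \<gamma>F: "\<gamma> s = F (of_real (s - t\<^sub>0))" if "\<bar>s - t\<^sub>0\<bar> < r" for s
  proof -
    have "complex_of_real (s - t\<^sub>0) \<in> ball 0 r" using that by (simp only: mem_ball dist_0_norm norm_of_real)
    from sums_unique2[OF c[OF that] F[OF this]] show ?thesis .
  qed
  have Fhol: "F holomorphic_on ball 0 r"
    by (rule power_series_holomorphic[where a = c]) (use F in simp)
  have F0: "F 0 = 0" using \<gamma>F[of t\<^sub>0] r arc(3) by simp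
  have c0: "c 0 = 0" using F[of 0] F0 r by simp
  have low1: "\<And>k. k < 1 \<Longrightarrow> c k = 0" using c0 by simp
  obtain G where G1: "G holomorphic_on ball 0 r" "\<And>z. z \<in> ball 0 r \<Longrightarrow> F z = z ^ 1 * G z"
    "G 0 = c 1" "(G has_field_derivative c (1 + 1)) (at 0)"
    by (rule power_series_shift[OF F r low1], assumption+, rule that)
  then have G: "\<And>z. z \<in> ball 0 r \<Longrightarrow> F z = z * G z" "G 0 = c 1" "(G has_field_derivative c 2) (at 0)"
    by (simp_all add: numeral_2_eq_2)
  have cd: "curve_deriv \<gamma> s = deriv F (of_real (s - t\<^sub>0))" if "\<bar>s - t\<^sub>0\<bar> < r" for s
    by (rule curve_deriv_power_series[OF Fhol \<gamma>F that])
  have Fd: "deriv F 0 = c 1" "deriv (deriv F) 0 = 2 * c 2"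
    using power_series_higher_deriv[OF F r, of 1] power_series_higher_deriv[OF F r, of 2]
    by (simp_all add: numeral_2_eq_2)
  define v where "v = c 1"
  have cd1: "curve_deriv \<gamma> t\<^sub>0 = v" using cd[of t\<^sub>0] r Fd by (simp add: v_def)
  have v0: "v \<noteq> 0" using I(2)[OF arc(2)] cd1 by simp
  have "curve_deriv (curve_deriv \<gamma>) t\<^sub>0 = deriv (deriv F) (of_real (t\<^sub>0 - t\<^sub>0))"
    by (rule curve_deriv_power_series[OF holomorphic_deriv[OF Fhol open_ball] cd]) (use r in auto)
  then have cd2: "curve_deriv (curve_deriv \<gamma>) t\<^sub>0 = 2 * c 2" using Fd by simp
  obtain W where W: "W holomorphic_on ball 0 1" "\<And>z. z \<in> ball 0 1 \<Longrightarrow> w z = z ^ n * W z"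
    "W 0 = a n" "(W has_field_derivative a (n + 1)) (at 0)"
    using power_series_shift[OF w(2) zero_less_one low] by blast
  \<comment> \<open>With F(s) = s G(s) and w(z) = z^n W(z), w along the curve is s^n H(s). Dividing
    by s^n for real s near 0 gives Re H = 0 there.\<close>
  define H where "H z = W (F z) * G z ^ n" for z
  have dF: "(F has_field_derivative v) (at 0)"
    using holomorphic_derivI[OF Fhol open_ball, of 0] r Fd by (simp add: v_def)
  have "((\<lambda>z. W (F z)) has_field_derivative a (n + 1) * v) (at 0)"
    by (rule DERIV_chain2[OF _ dF]) (use W(4) F0 in simp)
  moreover have "((\<lambda>z. G z ^ n) has_field_derivative of_nat n * (c 2 * G 0 ^ (n - Suc 0))) (at 0)"
    by (rule DERIV_power[OF G(3)])
  ultimately have dH: "(H has_field_derivative (a (n + 1) * v) * G 0 ^ n + (of_nat n * (c 2 * G 0 ^ (n - Suc 0))) * W (F 0)) (at 0)"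
    unfolding H_def by (rule DERIV_mult)
  have "eventually (\<lambda>s. s \<in> I) (nhds t\<^sub>0)" using I(1) arc(2) by (rule eventually_nhds_in_open)
  then obtain d where d: "d > 0" "\<And>s. \<bar>s - t\<^sub>0\<bar> < d \<Longrightarrow> s \<in> I"
    by (auto simp: eventually_nhds_metric dist_real_def)
  define \<delta> where "\<delta> = min d r"
  have \<delta>: "\<delta> > 0" using d r by (simp add: \<delta>_def)
  have ReH: "Re (H (of_real s)) = 0" if "\<bar>s\<bar> < \<delta>" "s \<noteq> 0" for s
  proof -
    have s: "t\<^sub>0 + s \<in> I" "\<gamma> (t\<^sub>0 + s) = F (of_real s)" "complex_of_real s \<in> ball 0 r"
      using that d(2)[of "t\<^sub>0 + s"] \<gamma>F[of "t\<^sub>0 + s"] by (auto simp: \<delta>_def)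
    have "F (of_real s) \<in> ball 0 1" "u (F (of_real s)) = 0" using I(3,4)[OF s(1)] s(2) by auto
    then have "Re (w (F (of_real s))) = 0" using u by simp
    moreover have "w (F (of_real s)) = of_real (s ^ n) * H (of_real s)"
      using W(2)[OF \<open>F (of_real s) \<in> ball 0 1\<close>] G(1)[OF s(3)]
      by (simp add: H_def power_mult_distrib mult_ac)
    ultimately show ?thesis using that by simp
  qed
  have ReH0: "Re (H 0) = 0"
  proof -
    have "isCont H 0" using dH by (rule DERIV_isCont)
    then have "isCont (\<lambda>s. H (complex_of_real s)) 0"
      by (intro isCont_o2[where f = complex_of_real and g = H]) auto
    then have "isCont (\<lambda>s. Re (H (complex_of_real s))) 0" by (rule continuous_Re)
    then have "((\<lambda>s. Re (H (complex_of_real s))) \<longlongrightarrow> Re (H 0)) (at 0)" by (simp add: isCont_def)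
    moreover have "eventually (\<lambda>s. Re (H (complex_of_real s)) = 0) (at 0)"
      unfolding eventually_at using \<delta> ReH by (auto simp: dist_real_def intro!: exI[of _ \<delta>])
    then have "((\<lambda>s. Re (H (complex_of_real s))) \<longlongrightarrow> 0) (at 0)" by (rule tendsto_eventually)
    ultimately show ?thesis by (rule tendsto_unique[OF at_neq_bot])
  qed
  have ReH': "Re ((a (n + 1) * v) * G 0 ^ n + (of_nat n * (c 2 * G 0 ^ (n - Suc 0))) * W (F 0)) = 0" (is "Re ?H' = 0")
  proof -
    have "(H has_field_derivative ?H') (at (0 + 1 * complex_of_real 0))" using dH by simp
    from has_vector_derivative_along_line[OF this]
    have "((\<lambda>s. H (complex_of_real s)) has_vector_derivative ?H') (at 0)" by simp
    then have "((\<lambda>s. Re (H (complex_of_real s))) has_real_derivative Re ?H') (at 0)"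
      unfolding has_real_derivative_iff_has_vector_derivative
      by (rule bounded_linear.has_vector_derivative[OF bounded_linear_Re])
    moreover have "((\<lambda>s. Re (H (complex_of_real s))) has_real_derivative 0) (at 0)"
    proof (rule has_field_derivative_transform_within_open[of "\<lambda>_. 0" _ _ "ball 0 \<delta>"])
      show "0 = Re (H (complex_of_real s))" if "s \<in> ball 0 \<delta>" for s
        using that ReH[of s] ReH0 by (cases "s = 0") auto
    qed (use \<delta> in auto)
    ultimately show ?thesis by (rule DERIV_unique)
  qed
  define R where "R = Im (a n * v ^ n)"
  have aR: "a n * v ^ n = \<i> * of_real R"
    using ReH0 by (simp add: complex_eq_iff R_def H_def F0 W(3) G(2) v_def)
  then have R0: "R \<noteq> 0" using an v0 by auto
  define b where "b = a (n + 1) / a n"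
  define X where "X = b * v + of_nat n * (c 2 / v)"
  have "?H' = a n * v ^ n * X"
  proof -
    have "v ^ n = v ^ (n - Suc 0) * v" using n by (cases n) auto
    then show ?thesis
      using an v0 unfolding F0 W(3) G(2) v_def [symmetric] by (simp add: X_def b_def field_simps)
  qed
  \<comment> \<open>H'(0) is X times the imaginary number a_n v^n = iR with R nonzero, so its
    vanishing real part means that X is real.\<close>
  then have "Re (\<i> * of_real R * X) = 0" using ReH' by (simp only: aR)
  then have "Im X = 0" using R0 by simp
  moreover have "Im (of_nat n * z) = real n * Im z" for z by simp
  ultimately have Im_bv: "Im (b * v) = - real n * Im (c 2 / v)"
    unfolding X_def plus_complex.sel by (simp only:)
  define Y where "Y = Im (cnj v * c 2)"
  have Im_quot: "Im (c 2 / v) = Y / (cmod v)\<^sup>2"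
    by (simp add: Y_def Im_divide cmod_power2 algebra_simps)
  have curv: "curvature \<gamma> t\<^sub>0 = 2 * Y / cmod v ^ 3"
    by (simp add: Y_def curvature_def cd1 cd2 algebra_simps)
  have bv: "Im (b * v) / cmod v = - (real n / 2) * curvature \<gamma> t\<^sub>0"
    unfolding Im_bv Im_quot curv by (simp add: power2_eq_square power3_eq_cube)
  define \<beta> where "\<beta> = Arg v"
  have cisv: "cis \<beta> = v / of_real (cmod v)"
    using rcis_cmod_Arg[of v] v0 by (simp add: \<beta>_def rcis_def field_simps)
  show ?thesis
  proof (rule that[of \<beta>])
    show "Re (a n * cis \<beta> ^ n) = 0"
      using aR by (simp add: cisv power_divide flip: of_real_power)
    have "Im (b * cis \<beta>) = Im (b * v) / cmod v" by (simp add: cisv)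
    then have "\<bar>Im (b * cis \<beta>)\<bar> = \<bar>- (real n / 2) * curvature \<gamma> t\<^sub>0\<bar>" using bv by simp
    then show "\<bar>Im (a (n + 1) / a n * cis \<beta>)\<bar> = real n / 2 * \<bar>curvature \<gamma> t\<^sub>0\<bar>"
      by (simp add: abs_mult b_def)
  qed
qed

subsection \<open>Sums of cosines with constrained phase\<close>

text \<open>The tangent line to the cosine at \<open>a\<close> stays above it on the whole of $[0, \pi]$ when \<open>a\<close>
  is small, although the cosine is not concave there.\<close>

lemma cos_le_tangent:
  fixes x a :: real
  assumes "0 < a" "a \<le> pi / 6" "\<bar>x\<bar> \<le> pi"
  shows "cos x \<le> cos a - sin a * (\<bar>x\<bar> - a)"
    and "cos x = cos a - sin a * (\<bar>x\<bar> - a) \<Longrightarrow> \<bar>x\<bar> = a"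
proof -
  \<comment> \<open>The derivative sin y - sin a is negative on [0, a), positive on (a, pi - a) and
    negative on (pi - a, pi], so apart from the zero at a only the endpoint pi needs a
    check.\<close>
  define f where "f y = cos a - sin a * (y - a) - cos y" for y
  have df: "(f has_real_derivative (sin y - sin a)) (at y)" for y
    unfolding f_def by (auto intro!: derivative_eq_intros)
  have "f a = 0" by (simp add: f_def)
  have less: "0 < f y" if "0 \<le> y" "y < a" for y
  proof -
    have "f y > f a"
    proof (rule DERIV_neg_imp_decreasing_open[OF that(2)])
      fix z assume "y < z" "z < a"
      then have "sin z < sin a" using that assms by (intro sin_monotone_2pi) auto
      then show "\<exists>d. DERIV f z :> d \<and> d < 0" using df[of z] by (intro exI conjI) auto
    qed (use df DERIV_isCont in \<open>blast intro: continuous_at_imp_continuous_on\<close>)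
    then show ?thesis using \<open>f a = 0\<close> by simp
  qed
  have mid: "0 < f y" if "a < y" "y \<le> pi - a" for y
  proof -
    have "f a < f y"
    proof (rule DERIV_pos_imp_increasing_open[OF that(1)])
      fix z assume z: "a < z" "z < y"
      have "sin z > sin a"
      proof (cases "z \<le> pi / 2")
        case True
        then show ?thesis using z assms by (intro sin_monotone_2pi) auto
      next
        case False
        then have "sin (pi - z) > sin a" using z that assms by (intro sin_monotone_2pi) auto
        then show ?thesis by simp
      qed
      then show "\<exists>d. DERIV f z :> d \<and> 0 < d" using df[of z] by (intro exI conjI) auto
    qed (use df DERIV_isCont in \<open>blast intro: continuous_at_imp_continuous_on\<close>)
    then show ?thesis using \<open>f a = 0\<close> by simp
  qed
  \<comment> \<open>For a <= pi/6 the value 1 + cos a - (pi - a) sin a is at least 1 + 17/20 - pi/2;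
    here 17/20 is a rational lower bound for cos(pi/6).\<close>
  have "f pi > 0"
  proof -
    have "cos a \<ge> cos (pi / 6)" using assms by (intro cos_monotone_0_pi_le) auto
    moreover have "sqrt 3 \<ge> 17 / 10" by (rule real_le_rsqrt) (simp add: power2_eq_square)
    ultimately have c: "cos a \<ge> 17 / 20" by (simp add: cos_30)
    have "sin a \<le> sin (pi / 6)" using assms by (intro sin_monotone_2pi_le) auto
    then have "sin a * (pi - a) \<le> 1 / 2 * pi"
      using assms by (intro mult_mono) (auto simp: sin_30)
    then show ?thesis using c pi_less_4 pi_approx by (simp add: f_def)
  qed
  have last: "0 < f y" if "pi - a < y" "y \<le> pi" for y
  proof (cases "y = pi")
    case False
    then have "y < pi" using that by simp
    then have "f y > f pi"
    proof (rule DERIV_neg_imp_decreasing_open)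
      fix z assume z: "y < z" "z < pi"
      have "sin (pi - z) < sin a" using z that assms by (intro sin_monotone_2pi) auto
      then show "\<exists>d. DERIV f z :> d \<and> d < 0" using df[of z] by (intro exI conjI) auto
    qed (use df DERIV_isCont in \<open>blast intro: continuous_at_imp_continuous_on\<close>)
    then show ?thesis using \<open>f pi > 0\<close> by simp
  qed (use \<open>f pi > 0\<close> in simp)
  have pos: "0 < f \<bar>x\<bar>" if "\<bar>x\<bar> \<noteq> a"
    using less[of "\<bar>x\<bar>"] mid[of "\<bar>x\<bar>"] last[of "\<bar>x\<bar>"] that assms by linarith
  then show "cos x \<le> cos a - sin a * (\<bar>x\<bar> - a)"
    using \<open>f a = 0\<close> by (cases "\<bar>x\<bar> = a") (auto simp: f_def)
  show "\<bar>x\<bar> = a" if "cos x = cos a - sin a * (\<bar>x\<bar> - a)"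
    using pos that by (auto simp: f_def)
qed

text \<open>Summing the tangent bounds gives card A * cos a - sin a * (sum |phi_i| - pi), whose last
  bracket is nonnegative. A sum as large as card A * cos a makes all bounds equalities, so |phi_i| =
  a; and |sum phi_i| >= pi = sum |phi_i| excludes mixed signs.\<close>

lemma sum_cos_le:
  fixes \<phi> :: "'i \<Rightarrow> real"
  assumes "finite A" "A \<noteq> {}" "real (card A) * a = pi" "a \<le> pi / 6"
    and bd: "\<And>i. i \<in> A \<Longrightarrow> \<bar>\<phi> i\<bar> \<le> pi" and sum: "pi \<le> \<bar>\<Sum>i\<in>A. \<phi> i\<bar>"
    and eq: "real (card A) * cos a \<le> (\<Sum>i\<in>A. cos (\<phi> i))"
  shows "\<exists>s. \<bar>s\<bar> = 1 \<and> (\<forall>i\<in>A. \<phi> i = s * a)"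
proof -
  have "card A > 0" using assms by auto
  then have a: "0 < a" using assms(3) by (metis of_nat_0_less_iff pi_gt_zero zero_less_mult_pos)
  define f where "f i = cos a - sin a * (\<bar>\<phi> i\<bar> - a) - cos (\<phi> i)" for i
  have f: "f i \<ge> 0" if "i \<in> A" for i
    using cos_le_tangent(1)[OF a assms(4) bd[OF that]] by (simp add: f_def)
  have sa: "sin a > 0" using a assms(4) by (intro sin_gt_zero) auto
  have abs: "pi \<le> (\<Sum>i\<in>A. \<bar>\<phi> i\<bar>)" using sum sum_abs[of \<phi> A] by linarith
  have "(\<Sum>i\<in>A. f i) = real (card A) * cos a - sin a * ((\<Sum>i\<in>A. \<bar>\<phi> i\<bar>) - real (card A) * a) - (\<Sum>i\<in>A. cos (\<phi> i))"
    by (simp add: f_def sum_subtractf sum_distrib_left sum.distrib right_diff_distrib)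
  also have "\<dots> \<le> - (sin a * ((\<Sum>i\<in>A. \<bar>\<phi> i\<bar>) - pi))" using eq assms(3) by simp
  finally have le: "(\<Sum>i\<in>A. f i) \<le> - (sin a * ((\<Sum>i\<in>A. \<bar>\<phi> i\<bar>) - pi))" .
  moreover have "sin a * ((\<Sum>i\<in>A. \<bar>\<phi> i\<bar>) - pi) \<ge> 0" using sa abs by simp
  moreover have "(\<Sum>i\<in>A. f i) \<ge> 0" using f by (rule sum_nonneg)
  ultimately have "(\<Sum>i\<in>A. f i) = 0" "sin a * ((\<Sum>i\<in>A. \<bar>\<phi> i\<bar>) - pi) = 0" by linarith+
  then have f0: "\<forall>i\<in>A. f i = 0" and sumabs: "(\<Sum>i\<in>A. \<bar>\<phi> i\<bar>) = pi"
    using sum_nonneg_eq_0_iff[OF assms(1), of f] f sa by auto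
  have absa: "\<bar>\<phi> i\<bar> = a" if "i \<in> A" for i
    using cos_le_tangent(2)[OF a assms(4) bd[OF that]] f0 that by (simp add: f_def)
  define s where "s = (if (\<Sum>i\<in>A. \<phi> i) \<ge> 0 then 1 else -1 :: real)"
  have "s * (\<Sum>i\<in>A. \<phi> i) = \<bar>\<Sum>i\<in>A. \<phi> i\<bar>" by (simp add: s_def)
  then have "(\<Sum>i\<in>A. \<bar>\<phi> i\<bar> - s * \<phi> i) \<le> 0"
    using sum sumabs by (simp add: sum_subtractf sum_distrib_left)
  moreover have nn: "\<bar>\<phi> i\<bar> - s * \<phi> i \<ge> 0" for i by (auto simp: s_def)
  ultimately have "(\<Sum>i\<in>A. \<bar>\<phi> i\<bar> - s * \<phi> i) = 0" by (intro antisym sum_nonneg)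
  then have "\<forall>i\<in>A. \<bar>\<phi> i\<bar> - s * \<phi> i = 0"
    using sum_nonneg_eq_0_iff[OF assms(1), of "\<lambda>i. \<bar>\<phi> i\<bar> - s * \<phi> i"] nn by simp
  then have "\<forall>i\<in>A. \<phi> i = s * a" using absa by (auto simp: s_def split: if_splits)
  moreover have "\<bar>s\<bar> = 1" by (simp add: s_def)
  ultimately show ?thesis by blast
qed

text \<open>For odd n the required value is the number 2n+2 of the cosines, so each is 1. For even n
  the phase makes the sum of angles an odd multiple of pi, hence at least pi in absolute value, and
  the common sign of the angles is the shift \<open>l\<close>.\<close>

lemma extremal_angles:
  fixes \<phi> :: "nat \<Rightarrow> real"
  assumes n: "n \<ge> 1" and bd: "\<And>j. j < 2 * n + 2 \<Longrightarrow> \<bar>\<phi> j\<bar> \<le> pi"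
    and cis: "cis (\<Sum>j<2 * n + 2. \<phi> j) = (-1) ^ (n + 1)"
    and ge: "(\<Sum>j<2 * n + 2. cos (\<phi> j)) \<ge> real n / 2 * curvature_bound n"
  obtains l where "l \<in> extremal_shifts n" "\<And>j. j < 2 * n + 2 \<Longrightarrow> \<phi> j = l * (pi / (2 * n + 2))"
proof (cases "odd n")
  case True
  then have "real n / 2 * curvature_bound n = 2 * real n + 2"
    using n by (simp add: curvature_bound_def field_simps)
  then have "(\<Sum>j<2 * n + 2. 1 - cos (\<phi> j)) \<le> 0"
    using ge unfolding sum_subtractf by simp
  moreover have nn: "1 - cos (\<phi> j) \<ge> 0" for j by simp
  ultimately have "(\<Sum>j<2 * n + 2. 1 - cos (\<phi> j)) = 0" by (intro antisym sum_nonneg) simp_all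
  then have "\<forall>j\<in>{..<2 * n + 2}. 1 - cos (\<phi> j) = 0"
    using sum_nonneg_eq_0_iff[of "{..<2 * n + 2}" "\<lambda>j. 1 - cos (\<phi> j)"] nn by blast
  then have "\<phi> j = 0" if "j < 2 * n + 2" for j
  proof -
    have "cos (\<phi> j) = 1" using \<open>\<forall>j\<in>_. _\<close> that by simp
    then obtain m :: int where m: "\<phi> j = of_int m * (2 * pi)" by (auto simp: cos_one_2pi_int)
    then have "\<bar>real_of_int m\<bar> * (2 * pi) < 1 * (2 * pi)"
      using bd[OF that] pi_gt_zero by (simp add: abs_mult)
    then have "\<bar>real_of_int m\<bar> < 1" using pi_gt_zero by (simp only: mult_less_cancel_right)
    then show ?thesis using m by simp
  qed
  then show ?thesis using True by (intro that[of 0]) (auto simp: extremal_shifts_def)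
next
  case False
  \<comment> \<open>From n = 2 on, pi/(2n+2) <= pi/6, as the tangent bound demands.\<close>
  then have "n \<ge> 2" using n by (cases "n = 1") auto
  define a where "a = pi / (2 * n + 2)"
  have "\<exists>s. \<bar>s\<bar> = 1 \<and> (\<forall>j\<in>{..<2 * n + 2}. \<phi> j = s * a)"
  proof (rule sum_cos_le)
    show "real (card {..<2 * n + 2}) * a = pi" by (simp add: a_def field_simps)
    show "a \<le> pi / 6" using \<open>n \<ge> 2\<close> by (simp add: a_def field_simps)
    show "pi \<le> \<bar>\<Sum>j<2 * n + 2. \<phi> j\<bar>"
    proof -
      have "cis (\<Sum>j<2 * n + 2. \<phi> j) = - 1" using cis False by simp
      then have "cos (\<Sum>j<2 * n + 2. \<phi> j) = -1" by (simp add: complex_eq_iff)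
      then obtain m :: int where "(\<Sum>j<2 * n + 2. \<phi> j) = (2 * of_int m + 1) * pi"
        using cos_eq_minus1 by blast
      moreover have "\<bar>2 * real_of_int m + 1\<bar> \<ge> 1"
      proof -
        have "\<bar>2 * m + 1\<bar> \<ge> 1" by presburger
        then show ?thesis by linarith
      qed
      ultimately show ?thesis by (simp add: abs_mult)
    qed
    have "a = pi / (2 * (real n + 1))" by (simp add: a_def algebra_simps)
    then have "curvature_bound n = 4 * (real n + 1) / real n * cos a"
      using False by (simp add: curvature_bound_def)
    then have "real n / 2 * curvature_bound n = real (card {..<2 * n + 2}) * cos a"
      using n by (simp add: field_simps)
    then show "real (card {..<2 * n + 2}) * cos a \<le> (\<Sum>j<2 * n + 2. cos (\<phi> j))"
      using ge by simp
  qed (use bd in \<open>auto simp: lessThan_empty_iff\<close>)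
  then obtain s where "\<bar>s\<bar> = 1" "\<And>j. j < 2 * n + 2 \<Longrightarrow> \<phi> j = s * a" by auto
  then show ?thesis using False by (intro that[of s]) (auto simp: extremal_shifts_def a_def abs_if split: if_splits)
qed

subsection \<open>The extremal case\<close>

text \<open>Here \<open>t\<close> is t_n, \<open>t'\<close> is t_{n+1} and \<open>\<nu>\<close> is
  nu_1. Multiplying t'/t = nu/q + (sum of cis(-theta_j)) by cis beta and taking imaginary parts
  splits n/2 times the curvature bound into 2n cosines and a term of nu that is at most 2 cos
  psi.\<close>

lemma extremal_phase:
  fixes \<theta> :: "nat \<Rightarrow> real" and \<kappa> t t' \<nu> :: complex
  assumes n: "n \<ge> 1" and \<kappa>: "\<kappa> \<noteq> 0" "\<kappa> * (\<Prod>j<2 * n. cis (- \<theta> j)) = cnj \<kappa>" and t: "t \<noteq> 0"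
    and \<nu>: "\<nu> = \<kappa> * (t' - t * (\<Sum>j<2 * n. cis (- \<theta> j)))" "cmod \<nu> \<le> 2 * Re (\<kappa> * t)"
    and \<beta>: "Re (t * cis \<beta> ^ n) = 0" "\<bar>Im (t' / t * cis \<beta>)\<bar> = real n / 2 * curvature_bound n"
  obtains l \<epsilon> :: real where "l \<in> extremal_shifts n" "\<bar>\<epsilon>\<bar> = 1"
    "\<And>j. j < 2 * n \<Longrightarrow> cis (- \<theta> j) = cis (- \<theta> 0)"
    "cis (- \<theta> 0) = of_real \<epsilon> * \<i> * cis (l * (pi / (2 * n + 2))) * cis (- \<beta>)"
    "\<nu> = of_real (2 * Re (\<kappa> * t)) * cis (- \<theta> 0)"
    "\<kappa> * t = of_real (cmod (\<kappa> * t)) * cis (l * (pi / (2 * n + 2)))"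
proof -
  define B where "B = real n / 2 * curvature_bound n"
  define q where "q = \<kappa> * t"
  have q: "q \<noteq> 0" using \<kappa> t by (simp add: q_def)
  \<comment> \<open>The sign of the signed curvature expression, which the absolute value in the
    hypothesis hides.\<close>
  define \<epsilon> where "\<epsilon> = (if Im (t' / t * cis \<beta>) \<ge> 0 then 1 else - 1 :: real)"
  have \<epsilon>: "\<bar>\<epsilon>\<bar> = 1" "\<epsilon> * Im (t' / t * cis \<beta>) = B" "\<epsilon> * \<epsilon> = 1"
    using \<beta>(2) by (auto simp: \<epsilon>_def B_def)
  define \<psi> where "\<psi> = Arg q"
  have q\<psi>: "q = of_real (cmod q) * cis \<psi>" using rcis_cmod_Arg[of q] by (simp add: \<psi>_def rcis_def)
  \<comment> \<open>Its real part epsilon * Im(cis(beta - theta_j)) is the contribution of zero j,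
    so its argument is the angle whose cosine is summed.\<close>
  define \<omega> where "\<omega> j = - (of_real \<epsilon> * \<i>) * cis (\<beta> - \<theta> j)" for j
  have cmod\<omega>: "cmod (\<omega> j) = 1" for j using \<epsilon>(1) by (simp add: \<omega>_def norm_mult)
  \<comment> \<open>Both indices 2n and 2n+1 carry psi, to account for the bound 2 cos psi.\<close>
  define \<phi> where "\<phi> j = (if j < 2 * n then Arg (\<omega> j) else \<psi>)" for j
  have cis\<phi>: "cis (\<phi> j) = \<omega> j" if "j < 2 * n" for j
    using rcis_cmod_Arg[of "\<omega> j"] that cmod\<omega>[of j] by (simp add: \<phi>_def rcis_def)
  have split: "(\<Sum>j<2 * n + 2. f j) = (\<Sum>j<2 * n. f j) + (f (2 * n) + f (2 * n + 1))"
    for f :: "nat \<Rightarrow> real" by simp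
  have phase: "cis (\<Sum>j<2 * n + 2. \<phi> j) = (- 1) ^ (n + 1)"
  proof -
    have "cis (sum f A) = (\<Prod>j\<in>A. cis (f j))" if "finite A" for f :: "nat \<Rightarrow> real" and A
      using that by (induction A) (auto simp flip: cis_mult)
    then have "cis (\<Sum>j<2 * n + 2. \<phi> j) = (\<Prod>j<2 * n. cis (\<phi> j)) * (cis \<psi> * cis \<psi>)"
      by (simp only: split finite_lessThan flip: cis_mult) (simp add: \<phi>_def)
    also have "(\<Prod>j<2 * n. cis (\<phi> j)) = (\<Prod>j<2 * n. - (of_real \<epsilon> * \<i>) * cis \<beta> * cis (- \<theta> j))"
      by (intro prod.cong) (auto simp: cis\<phi> \<omega>_def cis_mult mult.assoc)
    also have "\<dots> = (- (of_real \<epsilon> * \<i>)) ^ (2 * n) * cis \<beta> ^ (2 * n) * (\<Prod>j<2 * n. cis (- \<theta> j))"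
      by (simp only: prod.distrib prod_constant card_lessThan)
    also have "(- (of_real \<epsilon> * \<i>)) ^ (2 * n) = (- 1) ^ n"
    proof -
      have "(- (complex_of_real \<epsilon> * \<i>))\<^sup>2 = - of_real (\<epsilon> * \<epsilon>)"
        by (simp add: power_mult_distrib flip: power2_eq_square)
      then show ?thesis using \<epsilon>(3) by (simp add: power_mult)
    qed
    finally have 1: "cis (\<Sum>j<2 * n + 2. \<phi> j) =
        (- 1) ^ n * cis \<beta> ^ (2 * n) * (\<Prod>j<2 * n. cis (- \<theta> j)) * (cis \<psi> * cis \<psi>)" .
    define R where "R = Im (t * cis \<beta> ^ n)"
    have R: "t * cis \<beta> ^ n = \<i> * of_real R" using \<beta>(1) by (simp add: R_def complex_eq_iff)
    then have "cmod (t * cis \<beta> ^ n) = \<bar>R\<bar>" by (simp add: norm_mult)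
    then have R2: "R\<^sup>2 = (cmod t)\<^sup>2" by (simp add: norm_mult norm_power)
    have c2: "cis \<beta> ^ (2 * n) = cis \<beta> ^ n * cis \<beta> ^ n" by (simp add: mult_2 power_add)
    \<comment> \<open>Both constraints enter: kappa times the product is the conjugate of kappa
      because p is real, and (t cis(beta)^n)^2 = -|t|^2 by the tangent condition.\<close>
    have "q * q * cis \<beta> ^ (2 * n) * (\<Prod>j<2 * n. cis (- \<theta> j))
        = \<kappa> * (\<kappa> * (\<Prod>j<2 * n. cis (- \<theta> j))) * (t * cis \<beta> ^ n)\<^sup>2"
      unfolding c2 by (simp add: q_def power2_eq_square mult_ac)
    also have "\<dots> = (\<kappa> * cnj \<kappa>) * - of_real (R\<^sup>2)"
      unfolding \<kappa>(2) R by (simp add: power_mult_distrib)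
    also have "\<dots> = - of_real ((cmod q)\<^sup>2)"
      by (simp add: R2 complex_norm_square [symmetric] q_def norm_mult power_mult_distrib)
    finally have eq: "of_real ((cmod q)\<^sup>2) * (cis \<psi> * cis \<psi> * cis \<beta> ^ (2 * n) * (\<Prod>j<2 * n. cis (- \<theta> j)))
        = of_real ((cmod q)\<^sup>2) * (- 1)"
      by (subst (asm) q\<psi>, subst (asm) (2) q\<psi>) (simp add: power2_eq_square mult_ac)
    have "complex_of_real ((cmod q)\<^sup>2) \<noteq> 0" using q by simp
    from mult_left_cancel[OF this] eq have "cis \<psi> * cis \<psi> * cis \<beta> ^ (2 * n) * (\<Prod>j<2 * n. cis (- \<theta> j)) = - 1"
      by blast
    note prod_phase = this
    have "cis (\<Sum>j<2 * n + 2. \<phi> j) =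
        (- 1) ^ n * (cis \<psi> * cis \<psi> * cis \<beta> ^ (2 * n) * (\<Prod>j<2 * n. cis (- \<theta> j)))"
      unfolding 1 by (simp only: mult_ac)
    then show ?thesis by (simp only: prod_phase power_add power_one_right)
  qed
  \<comment> \<open>The share of nu_1 in the curvature is Im x, and |nu_1| <= 2 Re q becomes |x| <=
    2 cos psi.\<close>
  define x where "x = of_real \<epsilon> * (cis \<beta> * (\<nu> / q))"
  have cmodx: "cmod x \<le> 2 * cos \<psi>"
  proof -
    have "cmod x = cmod \<nu> / cmod q" using \<epsilon>(1) by (simp add: x_def norm_mult norm_divide)
    also have "\<dots> \<le> 2 * Re q / cmod q" using \<nu>(2) by (intro divide_right_mono) (auto simp: q_def)
    also have "Re q = cmod q * cos \<psi>" using arg_cong[OF q\<psi>, of Re] by simp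
    finally show ?thesis using q by simp
  qed
  have Bx: "B = Im x + (\<Sum>j<2 * n. cos (\<phi> j))"
  proof -
    have "\<nu> / q = t' / t - (\<Sum>j<2 * n. cis (- \<theta> j))"
      using \<kappa> t by (simp add: \<nu>(1) q_def field_simps)
    then have "t' / t = \<nu> / q + (\<Sum>j<2 * n. cis (- \<theta> j))" by simp
    then have "t' / t * cis \<beta> = cis \<beta> * (\<nu> / q) + (\<Sum>j<2 * n. cis \<beta> * cis (- \<theta> j))"
      by (simp only: distrib_left sum_distrib_left mult.commute[of _ "cis \<beta>"])
    then have "t' / t * cis \<beta> = cis \<beta> * (\<nu> / q) + (\<Sum>j<2 * n. cis (\<beta> - \<theta> j))"
      by (simp add: cis_mult)
    then have "B = \<epsilon> * (Im (cis \<beta> * (\<nu> / q)) + (\<Sum>j<2 * n. Im (cis (\<beta> - \<theta> j))))"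
      using \<epsilon>(2) by (simp only: plus_complex.sel Im_sum)
    moreover have "Im x = \<epsilon> * Im (cis \<beta> * (\<nu> / q))" by (simp only: x_def Im_complex_of_real Re_complex_of_real times_complex.sel)
    ultimately have "B = Im x + (\<Sum>j<2 * n. \<epsilon> * Im (cis (\<beta> - \<theta> j)))"
      by (simp only: distrib_left sum_distrib_left)
    also have "(\<Sum>j<2 * n. \<epsilon> * Im (cis (\<beta> - \<theta> j))) = (\<Sum>j<2 * n. cos (\<phi> j))"
    proof (intro sum.cong refl)
      fix j assume "j \<in> {..<2 * n}"
      then have "cos (\<phi> j) = Re (\<omega> j)" using cis\<phi>[of j] by (simp flip: cis.sel(1))
      then show "\<epsilon> * Im (cis (\<beta> - \<theta> j)) = cos (\<phi> j)" by (simp add: \<omega>_def)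
    qed
    finally show ?thesis .
  qed
  have Imx: "Im x \<le> 2 * cos \<psi>" using cmodx abs_Im_le_cmod[of x] by linarith
  have bd: "\<bar>\<phi> j\<bar> \<le> pi" for j
    using Arg_bounded[of "\<omega> j"] Arg_bounded[of q] by (auto simp: \<phi>_def \<psi>_def)
  have "(\<Sum>j<2 * n + 2. cos (\<phi> j)) \<ge> real n / 2 * curvature_bound n"
    using Bx Imx by (simp only: split B_def [symmetric]) (simp add: \<phi>_def)
  from extremal_angles[OF n bd phase this] obtain l where l: "l \<in> extremal_shifts n"
    "\<And>j. j < 2 * n + 2 \<Longrightarrow> \<phi> j = l * (pi / (2 * n + 2))" by blast
  define \<delta> where "\<delta> = l * (pi / (2 * n + 2))"
  have \<psi>\<delta>: "\<psi> = \<delta>" using l(2)[of "2 * n"] by (simp add: \<phi>_def \<delta>_def)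
  have "B = (2 * real n + 2) * cos \<delta>"
  proof (cases "odd n")
    case True
    then show ?thesis using l(1) n by (simp add: B_def curvature_bound_def extremal_shifts_def \<delta>_def field_simps)
  next
    case False
    then have "cos \<delta> = cos (pi / (2 * (real n + 1)))"
      using l(1) by (auto simp: extremal_shifts_def \<delta>_def algebra_simps)
    then show ?thesis using False n by (simp add: B_def curvature_bound_def field_simps)
  qed
  moreover have "(\<Sum>j<2 * n. cos (\<phi> j)) = (\<Sum>j<2 * n. cos \<delta>)"
    by (intro sum.cong refl) (simp add: l(2) \<delta>_def)
  ultimately have "Im x = 2 * cos \<psi>" using Bx by (simp add: \<psi>\<delta> algebra_simps)
  \<comment> \<open>The imaginary part already exhausts the bound on |x|.\<close>
  moreover have "Re x = 0"
  proof -
    have "(cmod x)\<^sup>2 \<le> (2 * cos \<psi>)\<^sup>2" using cmodx by (intro power_mono) auto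
    then show ?thesis using \<open>Im x = _\<close> by (simp add: cmod_power2)
  qed
  ultimately have x: "x = \<i> * of_real (2 * cos \<psi>)" by (simp add: complex_eq_iff)
  have \<epsilon>c: "complex_of_real \<epsilon> * complex_of_real \<epsilon> = 1" using \<epsilon>(3) by (simp flip: of_real_mult)
  have e: "cis (- \<theta> j) = of_real \<epsilon> * \<i> * cis \<delta> * cis (- \<beta>)" if "j < 2 * n" for j
  proof -
    have "cis \<delta> = - (of_real \<epsilon> * \<i>) * cis (\<beta> - \<theta> j)"
      using cis\<phi>[OF that] l(2)[of j] that by (simp add: \<omega>_def \<delta>_def)
    then have "of_real \<epsilon> * \<i> * cis \<delta> * cis (- \<beta>) =
        - (of_real \<epsilon> * of_real \<epsilon>) * (\<i> * \<i>) * (cis (\<beta> - \<theta> j) * cis (- \<beta>))"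
      by (simp add: mult_ac)
    also have "\<dots> = cis (- \<theta> j)" by (simp add: \<epsilon>c cis_mult)
    finally show ?thesis by simp
  qed
  have e0: "cis (- \<theta> 0) = of_real \<epsilon> * \<i> * cis \<delta> * cis (- \<beta>)" using e[of 0] n by simp
  \<comment> \<open>Solving the definition of x for nu yields nu_1 = nu_0 e^{-i theta_0}, the
    hypothesis of \<open>fourier_point_mass\<close>.\<close>
  have "\<nu> = of_real \<epsilon> * cis (- \<beta>) * q * x"
  proof -
    have "of_real \<epsilon> * cis (- \<beta>) * q * x = (of_real \<epsilon> * of_real \<epsilon>) * (cis (- \<beta>) * cis \<beta>) * (q * (\<nu> / q))"
      by (simp only: x_def mult_ac)
    then show ?thesis using q by (simp add: \<epsilon>c cis_mult)
  qed
  also have "\<dots> = of_real (2 * (cmod q * cos \<psi>)) * (of_real \<epsilon> * \<i> * cis \<delta> * cis (- \<beta>))"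
    by (subst q\<psi>) (simp add: x \<psi>\<delta> mult_ac)
  also have "cmod q * cos \<psi> = Re q" using arg_cong[OF q\<psi>, of Re] by simp
  finally have "\<nu> = of_real (2 * Re q) * cis (- \<theta> 0)" by (simp only: e0)
  then show ?thesis
    using q\<psi> e e0 by (intro that[OF l(1) \<epsilon>(1)]) (auto simp: q_def \<psi>\<delta> \<delta>_def)
qed

text \<open>A geometric series whose first coefficient B is corrected to A, matching the exceptional
  term k = 0 in \<open>zero_poly_times_series\<close>.\<close>

lemma point_mass_generating_series:
  fixes e z A B :: complex
  assumes "cmod (e * z) < 1"
  shows "(\<lambda>k. z ^ (n + k) * (if k = 0 then A else B * e ^ k)) sums (z ^ n * (A + B * (e * z / (1 - e * z))))"
proof -
  have "(\<lambda>k. B * (e * z) ^ k + (if k = 0 then A - B else 0)) sums (B * (1 / (1 - e * z)) + (A - B))"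
    by (intro sums_add sums_mult geometric_sums assms sums_single)
  from sums_mult[OF this, of "z ^ n"]
  have "(\<lambda>k. z ^ n * (B * (e * z) ^ k + (if k = 0 then A - B else 0))) sums (z ^ n * (B * (1 / (1 - e * z)) + (A - B)))" .
  moreover have "z ^ n * (B * (e * z) ^ k + (if k = 0 then A - B else 0)) = z ^ (n + k) * (if k = 0 then A else B * e ^ k)" for k
    by (simp add: power_add power_mult_distrib mult_ac)
  moreover have "B * (1 / (1 - e * z)) + (A - B) = A + B * (e * z / (1 - e * z))"
  proof -
    have "e * z \<noteq> 1" using assms by auto
    then show ?thesis by (simp add: field_simps)
  qed
  ultimately show ?thesis by (simp only:)
qed

text \<open>Rotation by tau - phi moves the common zero from tau to phi. The constant a e^{i n
  alpha} left over can be divided out by a real factor because it is real, which rests on n (phi +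
  delta) = l pi/2.\<close>

lemma rotated_extremal_function:
  fixes w :: "complex \<Rightarrow> complex" and a :: complex and l \<epsilon> \<tau> \<beta> :: real
  assumes n: "n \<ge> 1" and l: "l \<in> extremal_shifts n" and \<epsilon>: "\<bar>\<epsilon>\<bar> = 1" and a: "a \<noteq> 0"
    and \<delta>: "\<delta> = l * (pi / (2 * real n + 2))" and \<beta>: "Re (a * cis \<beta> ^ n) = 0"
    and \<tau>: "cis (- \<tau>) = of_real \<epsilon> * \<i> * cis \<delta> * cis (- \<beta>)"
    and w: "\<And>z. z \<in> ball 0 1 \<Longrightarrow> w z = a * z ^ n * (1 / (1 - cis (- \<tau>) * z) ^ (2 * n) +
         2 * of_real (cos \<delta>) * cis (- \<delta>) * (cis (- \<tau>) * z) / (1 - cis (- \<tau>) * z) ^ (2 * n + 1))"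
    and \<phi>: "\<phi> = pi / (2 * real n * (real n + 1)) * l"
  obtains c \<alpha> :: real where "c \<noteq> 0"
    "\<And>z. z \<in> ball 0 1 \<Longrightarrow> complex_of_real c * w (exp (\<i> * complex_of_real \<alpha>) * z) = extremal_function n \<phi> z"
proof -
  define \<alpha> where "\<alpha> = \<tau> - \<phi>"
  have "2 * real n * (real n + 1) = real n * (2 * real n + 2)" by (simp add: algebra_simps)
  then have n\<phi>: "real n * \<phi> = \<delta>" using n by (simp add: \<phi> \<delta>)
  have N\<delta>: "real n * \<phi> + real n * \<delta> = l * (pi / 2)"
  proof -
    have "real (2 * n + 2) = 2 * (real n + 1)" by simp
    then have "\<delta> = l * (pi / 2) / (real n + 1)" by (simp only: \<delta>) simp
    moreover have "real n + 1 \<noteq> 0" by simp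
    ultimately have "\<delta> * (real n + 1) = l * (pi / 2)" using nonzero_eq_divide_eq by blast
    moreover have "\<delta> + real n * \<delta> = \<delta> * (real n + 1)" by (simp add: algebra_simps)
    ultimately show ?thesis by (simp only: n\<phi>)
  qed
  have \<epsilon>c: "complex_of_real \<epsilon> * complex_of_real \<epsilon> = 1" using \<epsilon>
    by (simp add: abs_if flip: of_real_mult split: if_splits)
  have cis\<alpha>: "cis \<alpha> = - (of_real \<epsilon> * \<i>) * cis \<beta> * cis (- \<phi> - \<delta>)"
  proof -
    have "cis (- \<tau>) * (- (of_real \<epsilon> * \<i>) * cis \<beta> * cis (- \<phi> - \<delta>)) =
        (of_real \<epsilon> * of_real \<epsilon>) * (cis \<delta> * cis (- \<beta>) * cis \<beta> * cis (- \<phi> - \<delta>))"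
      unfolding \<tau> by (simp add: algebra_simps)
    also have "\<dots> = cis (- \<phi>)" by (simp add: \<epsilon>c cis_mult)
    finally have "cis \<tau> * (cis (- \<tau>) * (- (of_real \<epsilon> * \<i>) * cis \<beta> * cis (- \<phi> - \<delta>))) = cis \<tau> * cis (- \<phi>)"
      by simp
    then show ?thesis by (simp add: \<alpha>_def cis_mult mult.assoc[symmetric])
  qed
  \<comment> \<open>The tangent condition supplies a factor i. For odd n the odd power of i makes
    the product real, for even n the factor e^{-i l pi/2} with l = 1 or -1 does.\<close>
  have real: "Im (a * cis \<alpha> ^ n) = 0"
  proof -
    define R where "R = Im (a * cis \<beta> ^ n)"
    have R: "a * cis \<beta> ^ n = \<i> * of_real R" using \<beta> by (simp add: R_def complex_eq_iff)
    have "real n * (- \<phi> - \<delta>) = - (l * (pi / 2))"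
      using N\<delta> by (simp add: algebra_simps)
    then have "cis (- \<phi> - \<delta>) ^ n = cis (- (l * (pi / 2)))" by (simp only: Complex.DeMoivre)
    then have eq: "a * cis \<alpha> ^ n = \<i> * of_real R * (- (of_real \<epsilon> * \<i>)) ^ n * cis (- (l * (pi / 2)))"
      unfolding cis\<alpha> power_mult_distrib R [symmetric] by (simp add: mult_ac)
    have sq: "(- (complex_of_real \<epsilon> * \<i>)) ^ (2 * m) = of_real ((- 1) ^ m)" for m
    proof -
      have "(- (complex_of_real \<epsilon> * \<i>))\<^sup>2 = - 1"
        using \<epsilon>c by (simp add: power_mult_distrib flip: power2_eq_square)
      then show ?thesis by (simp add: power_mult)
    qed
    show ?thesis
    proof (cases "odd n")
      case True
      then obtain m where m: "n = 2 * m + 1" by (elim oddE)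
      have "l = 0" using True l by (simp add: extremal_shifts_def)
      then have "a * cis \<alpha> ^ n = of_real (R * (- 1) ^ m * \<epsilon>)"
        unfolding eq unfolding m power_add sq by (simp add: algebra_simps)
      then show ?thesis by (simp only: Im_complex_of_real)
    next
      case False
      then have "even n" by simp
      then obtain m where m: "n = 2 * m" by (elim evenE)
      have "cis (- (l * (pi / 2))) = - of_real l * \<i>"
        using False l by (auto simp: extremal_shifts_def complex_eq_iff)
      then have "a * cis \<alpha> ^ n = of_real (R * (- 1) ^ m * l)"
        unfolding eq unfolding m sq by (simp add: algebra_simps)
      then show ?thesis by (simp only: Im_complex_of_real)
    qed
  qed
  define X where "X = Re (a * cis \<alpha> ^ n)"
  have X: "a * cis \<alpha> ^ n = of_real X" using real by (simp add: complex_eq_iff X_def)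
  have "a * cis \<alpha> ^ n \<noteq> 0" using a by simp
  then have X0: "X \<noteq> 0" unfolding X by simp
  define c where "c = 1 / X"
  have c: "c \<noteq> 0" "complex_of_real c * (a * cis \<alpha> ^ n) = 1"
    using X0 unfolding X by (simp_all add: c_def)
  show ?thesis
  proof (rule that[OF c(1), of \<alpha>])
    fix z :: complex assume z: "z \<in> ball 0 1"
    define e where "e = cis (- \<phi>)"
    have e: "cis (- \<tau>) * (cis \<alpha> * z) = e * z"
      by (simp add: e_def \<alpha>_def cis_mult flip: mult.assoc)
    have "cis \<alpha> * z \<in> ball 0 1" using z by (simp add: norm_mult)
    from w[OF this] have "w (cis \<alpha> * z) = a * cis \<alpha> ^ n * (z ^ n * (1 / (1 - e * z) ^ (2 * n) +
         2 * of_real (cos \<delta>) * cis (- \<delta>) * (e * z) / (1 - e * z) ^ (2 * n + 1)))"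
      unfolding e by (simp only: power_mult_distrib mult.assoc)
    then have "complex_of_real c * w (cis \<alpha> * z) = z ^ n * (1 / (1 - e * z) ^ (2 * n) +
         2 * of_real (cos \<delta>) * cis (- \<delta>) * (e * z) / (1 - e * z) ^ (2 * n + 1))"
      using c(2) by (simp only: mult.assoc[symmetric] mult_1_left)
    also have "\<dots> = z ^ n / (1 - e * z) ^ (2 * n) +
        2 * z ^ (n + 1) / (1 - e * z) ^ (2 * n + 1) * (cis (- \<delta>) * e) * of_real (cos \<delta>)"
      by (simp add: distrib_left mult_ac)
    also have "cis (- \<delta>) * e = exp (- (\<i> * complex_of_real ((real n + 1) * \<phi>)))"
    proof -
      have "cis (- \<delta>) * e = cis (- ((real n + 1) * \<phi>))"
        by (simp add: e_def cis_mult distrib_right n\<phi>)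
      then show ?thesis by (simp add: cis_conv_exp)
    qed
    also have "e = exp (- (\<i> * complex_of_real \<phi>))" by (simp add: e_def cis_conv_exp)
    finally show "complex_of_real c * w (exp (\<i> * complex_of_real \<alpha>) * z) = extremal_function n \<phi> z"
      by (simp only: extremal_function_def n\<phi> cis_conv_exp)
  qed
qed

theorem theorem3:
  fixes n :: nat
    and T :: "(real \<Rightarrow> real) \<Rightarrow> real"
    and u :: "complex \<Rightarrow> real"
    and w :: "complex \<Rightarrow> complex"
    and \<gamma> :: "real \<Rightarrow> complex"
    and I :: "real set"
    and t\<^sub>0 :: real
  assumes "n \<ge> 1"
    and "circle_distribution T"
    and "almost_changes_sign T (2 * n)"
    and "u = poisson_extension T"
    and "vanishes_to_order u n 0"
    and "w holomorphic_on ball 0 1"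
    and "\<forall>z \<in> ball 0 1. Re (w z) = u z"
    and "w 0 = 0"
    and "nodal_curve u I \<gamma>"
    and "t\<^sub>0 \<in> I"
    and "\<gamma> t\<^sub>0 = 0"
    and "\<bar>curvature \<gamma> t\<^sub>0\<bar> = curvature_bound n"
  shows "\<exists>(c :: real) (\<alpha> :: real) (k :: nat) (l :: real) (\<phi>\<^sub>0 :: real).
           c \<noteq> 0 \<and> k \<le> n - 1 \<and> l \<in> extremal_shifts n \<and>
           \<phi>\<^sub>0 = real k * pi / real n + pi / (2 * real n * (real n + 1)) * l \<and>
           (\<forall>z \<in> ball 0 1.
              complex_of_real c * w (exp (\<i> * complex_of_real \<alpha>) * z) = extremal_function n \<phi>\<^sub>0 z)"
proof -
  note n = assms(1)
  note lin = circle_distribution_linear[OF assms(2)]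
  define a where "a k = fourier T (int k) / of_real pi" for k
  have ser: "(\<lambda>k. a k * z ^ k) sums w z" if "z \<in> ball 0 1" for z
    unfolding a_def by (rule conjugate_potential_series(2)[OF assms(2,4,6,7,8) that])
  have hd: "(deriv ^^ k) w 0 = fact k * a k" for k
    by (rule power_series_higher_deriv[OF ser zero_less_one])
  have uRe: "u z = Re (w z)" if "z \<in> ball 0 1" for z using assms(7) that by simp
  have van: "m < n \<Longrightarrow> (deriv ^^ m) w 0 = 0" "(deriv ^^ n) w 0 \<noteq> 0" for m
    by (rule vanishes_to_order_higher_deriv[OF assms(6) uRe assms(8,5)]; assumption)+
  have low: "a k = 0" if "k < n" for k using van(1)[OF that] hd[of k] by simp
  have an: "a n \<noteq> 0" using van(2) hd[of n] by simp
  have fn: "fourier T (int n) \<noteq> 0" using an by (auto simp: a_def)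
  \<comment> \<open>Negative indices follow by conjugation, since T is real.\<close>
  have f0: "fourier T k = 0" if "\<bar>k\<bar> < int n" for k
  proof -
    have "fourier T (int (nat \<bar>k\<bar>)) = 0" using low[of "nat \<bar>k\<bar>"] that by (simp add: a_def)
    then show ?thesis
      using fourier_minus[OF lin, of k] by (cases "k \<ge> 0") auto
  qed
  obtain \<theta> \<sigma> where \<sigma>: "\<bar>\<sigma>\<bar> = 1"
    and smooth: "(\<lambda>t. \<sigma> * (\<Prod>j<2 * n. sin ((t - \<theta> j) / 2))) \<in> smooth_circle"
    and pos: "\<And>f. f \<in> smooth_circle \<Longrightarrow> (\<And>x. f x \<ge> 0) \<Longrightarrow>
       T (\<lambda>t. (\<sigma> * (\<Prod>j<2 * n. sin ((t - \<theta> j) / 2))) * f t) \<ge> 0"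
    by (rule almost_changes_sign_trig[OF assms(3)]) auto
  define L where "L = weighted n \<theta> \<sigma> T"
  have L_eq: "L = (\<lambda>f. T (\<lambda>t. (\<sigma> * (\<Prod>j<2 * n. sin ((t - \<theta> j) / 2))) * f t))"
    by (simp add: L_def fun_eq_iff weighted_def trig_poly_def)
  have linL: "linear_functional L" unfolding L_eq by (rule linear_functional_weighted[OF lin smooth])
  have posL: "\<And>f. f \<in> smooth_circle \<Longrightarrow> (\<And>x. f x \<ge> 0) \<Longrightarrow> L f \<ge> 0" unfolding L_eq by (rule pos)
  define \<kappa> where "\<kappa> = trig_const n \<theta> \<sigma>"
  note \<kappa> = trig_const_nonzero[OF \<sigma>, of n \<theta>, folded \<kappa>_def] trig_const_mult[of n \<theta> \<sigma>, folded \<kappa>_def]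
  define t where "t = fourier T (int n)"
  have \<nu>0: "fourier L 0 = of_real (2 * Re (\<kappa> * t))"
    unfolding L_def \<kappa>_def t_def by (subst fourier_weighted_0[OF n \<sigma> lin f0]) simp_all
  have \<nu>1: "fourier L 1 = \<kappa> * (fourier T (int n + 1) - t * (\<Sum>j<2 * n. cis (- \<theta> j)))"
    unfolding L_def \<kappa>_def t_def by (rule fourier_weighted_1[OF n \<sigma> lin f0])
  have \<nu>1le: "cmod (fourier L 1) \<le> 2 * Re (\<kappa> * t)"
    using norm_fourier_le[OF linL posL, of 1] by (simp add: \<nu>0)
  have arc: "nodal_arc u I \<gamma>" using assms(9) by (simp add: nodal_curve_def)
  obtain \<beta> where \<beta>: "Re (a n * cis \<beta> ^ n) = 0"
    "\<bar>Im (a (n + 1) / a n * cis \<beta>)\<bar> = real n / 2 * \<bar>curvature \<gamma> t\<^sub>0\<bar>"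
    by (rule nodal_curvature[OF assms(6) ser low an n _ arc assms(10,11)]) (use assms(7) in auto)
  have \<beta>': "Re (t * cis \<beta> ^ n) = 0"
    "\<bar>Im (fourier T (int n + 1) / t * cis \<beta>)\<bar> = real n / 2 * curvature_bound n"
  proof -
    have "t * cis \<beta> ^ n = of_real pi * (a n * cis \<beta> ^ n)" by (simp add: a_def t_def)
    then show "Re (t * cis \<beta> ^ n) = 0" using \<beta>(1) by simp
    have "fourier T (int n + 1) / t = a (n + 1) / a n" by (simp add: a_def t_def add.commute)
    then show "\<bar>Im (fourier T (int n + 1) / t * cis \<beta>)\<bar> = real n / 2 * curvature_bound n"
      using \<beta>(2) assms(12) by simp
  qed
  obtain l \<epsilon> where l: "l \<in> extremal_shifts n" and \<epsilon>: "\<bar>\<epsilon>\<bar> = 1"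
    and same: "\<And>j. j < 2 * n \<Longrightarrow> cis (- \<theta> j) = cis (- \<theta> 0)"
    and e: "cis (- \<theta> 0) = of_real \<epsilon> * \<i> * cis (l * (pi / (2 * n + 2))) * cis (- \<beta>)"
    and \<nu>e: "fourier L 1 = of_real (2 * Re (\<kappa> * t)) * cis (- \<theta> 0)"
    and q: "\<kappa> * t = of_real (cmod (\<kappa> * t)) * cis (l * (pi / (2 * n + 2)))"
    by (rule extremal_phase[OF n \<kappa> fn[folded t_def] \<nu>1 \<nu>1le \<beta>']) (rule that; assumption)
  define \<delta> where "\<delta> = l * (pi / (2 * n + 2))"
  have \<delta>: "\<delta> = l * (pi / (2 * real n + 2))" by (simp add: \<delta>_def)
  have \<nu>k: "fourier L (int k) = fourier L 0 * cis (- \<theta> 0) ^ k" for k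
    by (rule fourier_point_mass[OF linL posL]) (simp_all only: \<nu>e \<nu>0)
  \<comment> \<open>From q = kappa t = |q| e^{i delta} follows nu_0 = 2 |q| cos delta, and dividing
    by kappa = q/t replaces |q| by t e^{-i delta}.\<close>
  define B where "B = fourier L 0 / \<kappa>"
  have B: "B = t * (2 * of_real (cos \<delta>) * cis (- \<delta>))"
  proof -
    have q': "\<kappa> * t = of_real (cmod (\<kappa> * t)) * cis \<delta>" using q by (simp only: \<delta>_def)
    then have "Re (\<kappa> * t) = cmod (\<kappa> * t) * cos \<delta>" by (metis Re_complex_of_real Im_complex_of_real times_complex.sel(1) cis.sel(1) mult_zero_left diff_zero)
    then have "fourier L 0 = of_real (cmod (\<kappa> * t)) * (2 * of_real (cos \<delta>))" by (simp add: \<nu>0)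
    also have "\<dots> = (of_real (cmod (\<kappa> * t)) * cis \<delta>) * (2 * of_real (cos \<delta>) * cis (- \<delta>))"
      by (simp add: cis_mult mult_ac)
    also have "\<dots> = \<kappa> * (t * (2 * of_real (cos \<delta>) * cis (- \<delta>)))" by (simp only: q' [symmetric] mult.assoc)
    finally show ?thesis using \<kappa>(1) by (simp add: B_def)
  qed
  have w: "w z = a n * z ^ n * (1 / (1 - cis (- \<theta> 0) * z) ^ (2 * n) +
       2 * of_real (cos \<delta>) * cis (- \<delta>) * (cis (- \<theta> 0) * z) / (1 - cis (- \<theta> 0) * z) ^ (2 * n + 1))"
    if z: "z \<in> ball 0 1" for z
  proof -
    define y where "y = 1 - cis (- \<theta> 0) * z"
    have ez: "cmod (cis (- \<theta> 0) * z) < 1" using z by (simp add: norm_mult)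
    have y: "y \<noteq> 0" using ez by (auto simp: y_def)
    have "(\<lambda>k. fourier T (int k) * z ^ k) sums (of_real pi * w z)"
      using sums_mult[OF ser[OF z], of "of_real pi"] by (simp add: a_def)
    from zero_poly_times_series[OF n \<sigma> lin f0 this, of \<theta>, folded L_def \<kappa>_def t_def]
    have "(\<lambda>k. z ^ (n + k) * (if k = 0 then t else fourier L (int k) / \<kappa>)) sums (poly (zero_poly n \<theta>) z * (of_real pi * w z))" .
    moreover have "fourier L (int k) / \<kappa> = B * cis (- \<theta> 0) ^ k" for k
      unfolding \<nu>k B_def by simp
    ultimately have "(\<lambda>k. z ^ (n + k) * (if k = 0 then t else B * cis (- \<theta> 0) ^ k)) sums (poly (zero_poly n \<theta>) z * (of_real pi * w z))"
      by (simp only:)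
    from sums_unique2[OF this point_mass_generating_series[OF ez]]
    have "poly (zero_poly n \<theta>) z * (of_real pi * w z) = z ^ n * (t + B * (cis (- \<theta> 0) * z / y))"
      by (simp only: y_def)
    moreover have "poly (zero_poly n \<theta>) z = y ^ (2 * n)"
    proof -
      have "poly (zero_poly n \<theta>) z = (\<Prod>j<2 * n. 1 - cis (- \<theta> j) * z)"
        by (simp add: zero_poly_def poly_prod mult.commute)
      also have "\<dots> = (\<Prod>j<2 * n. y)"
      proof (intro prod.cong refl)
        fix j assume "j \<in> {..<2 * n}"
        then show "1 - cis (- \<theta> j) * z = y" using same[of j] by (simp add: y_def)
      qed
      finally show ?thesis by simp
    qed
    ultimately have "y ^ (2 * n) * (of_real pi * w z) = z ^ n * t * (1 + 2 * of_real (cos \<delta>) * cis (- \<delta>) * (cis (- \<theta> 0) * z) / y)"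
      unfolding B by (simp add: algebra_simps)
    moreover have "t = of_real pi * a n" by (simp add: a_def t_def)
    ultimately have "y ^ (2 * n) * w z = z ^ n * a n * (1 + 2 * of_real (cos \<delta>) * cis (- \<delta>) * (cis (- \<theta> 0) * z) / y)"
      by (simp add: mult_ac)
    then have "w z = z ^ n * a n * (1 + 2 * of_real (cos \<delta>) * cis (- \<delta>) * (cis (- \<theta> 0) * z) / y) / y ^ (2 * n)"
      using y by (simp add: field_simps)
    also have "\<dots> = a n * z ^ n * (1 / y ^ (2 * n) + 2 * of_real (cos \<delta>) * cis (- \<delta>) * (cis (- \<theta> 0) * z) / y ^ (2 * n + 1))"
      by (simp add: add_divide_distrib distrib_left mult_ac)
    finally show ?thesis by (simp only: y_def)
  qed
  obtain c \<alpha> where "c \<noteq> 0"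
    "\<And>z. z \<in> ball 0 1 \<Longrightarrow> complex_of_real c * w (exp (\<i> * complex_of_real \<alpha>) * z)
       = extremal_function n (pi / (2 * real n * (real n + 1)) * l) z"
    by (rule rotated_extremal_function[OF n l \<epsilon> an \<delta> \<beta>(1) e[folded \<delta>_def] w refl], assumption, rule that)
  then show ?thesis
    using l by (intro exI[of _ c] exI[of _ \<alpha>] exI[of _ 0] exI[of _ l] exI) auto
qed

end
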